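(* As power series identities in $x,z$ near $(0,0)$, \[ \sum_{a=0}^\infty\sum_{c=0}^\infty\zeta^\ast(\{1\}^a,2,\{1\}^c)\,x^{a+1}z^c=-\frac{\psi(z-x+1)-\psi(z+1)}{\Gamma(z+1)e^{\gamma_E z}}, \] where $\Gamma$ is the gamma function, $\psi=\Gamma'/\Gamma$ the digamma function, and $\gamma_E$ Euler's constant.
   Context: $\{1\}^a$ denotes $1$ repeated $a$ times. For $\boldsymbol k=(k_1,\ldots,k_d)\in\mathbb{N}^d$, $\zeta^M(\boldsymbol k)=\sum_{1\le m_1<\cdots<m_d\le M}m_1^{-k_1}\cdots m_d^{-k_d}$, and the stuffle-regularized multiple zeta value is $\zeta^\ast(\boldsymbol k)=Z^\ast(\boldsymbol k;0)$, where $Z^\ast(\boldsymbol k;T)\in\mathbb{R}[T]$ is the unique polynomial with $\zeta^M(\boldsymbol k)=Z^\ast(\boldsymbol k;\log M+\gamma_E)+O(\log^JM/M)$ as $M\to\infty$ for some $J>0$. *)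

theory Defs
  imports "HOL-Analysis.Analysis" "HOL-Computational_Algebra.Polynomial"
    "HOL-Library.Landau_Symbols"
begin

text \<open>
  An index $(k_1,\ldots,k_d)$ of positive integers is a list. The summation variables increase
  from left to right, so the last entry is attached to the largest one, and convergence
  of the untruncated sum depends on the last entry being at least 2.
\<close>

definition mzv_trunc :: "nat list \<Rightarrow> nat \<Rightarrow> real" where
  "mzv_trunc ks M =
     (\<Sum>ms | length ms = length ks \<and> sorted_wrt (<) ms \<and> set ms \<subseteq> {1..M}.
        \<Prod>i<length ks. 1 / real (ms ! i) ^ (ks ! i))"

definition is_stuffle_reg_poly :: "nat list \<Rightarrow> real poly \<Rightarrow> bool" where
  "is_stuffle_reg_poly ks P \<longleftrightarrow>
     (\<exists>J::real. J > 0 \<and>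
        (\<lambda>M. mzv_trunc ks M - poly P (ln (real M) + euler_mascheroni))
          \<in> O(\<lambda>M. ln (real M) powr J / real M))"

definition stuffle_reg_poly :: "nat list \<Rightarrow> real poly" where
  "stuffle_reg_poly ks = (THE P. is_stuffle_reg_poly ks P)"

definition mzv_stuffle :: "nat list \<Rightarrow> real" where
  "mzv_stuffle ks = poly (stuffle_reg_poly ks) 0"

end

theory Submission
  imports Defs "HOL-Real_Asymp.Real_Asymp"
begin

text \<open>
  Multiply the generating function $T_a(M;z)=\sum_c\zeta^M(\{1\}^a,2,\{1\}^c)z^c$ by $e^{-L_Mz}$ with
  $L_M=\log M+\gamma_E$. The recursion in $M$ shows that consecutive coefficients of the product differ
  by $O(\log^JM/M^2)$, so they converge at rate $O(\log^JM/M)$; multiplying back by $e^{L_Mz}$ shows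
  that their limits are the values $\zeta^\ast(\{1\}^a,2,\{1\}^c)$. The same recursion bounds the
  coefficients by a constant times $4^{a+c}$ uniformly in $M$, hence the generating function of the
  limits is the limit, for $|x|,|z|<1/4$, of
  \[ e^{-L_Mz}\prod_{j\le M}\Bigl(1+\frac zj\Bigr)\sum_{m\le M}\frac1{m^2}
     \prod_{i<m}\Bigl(1+\frac xi\Bigr)\prod_{j\le m}\Bigl(1+\frac zj\Bigr)^{-1}. \]
  The factor in front of the sum tends to $e^{-\gamma_Ez}/\Gamma(z+1)$, and $x$ times the sum is a partial
  sum of $\sum_m\frac{(x)_m}{m\,(z+1)_m}$. Shifting $z$ by $1$ changes this series by the telescoping
  series $\frac1{z+1}\sum_m\frac{(x)_m}{(z+2)_m}$, so it equals
  $\sum_{n\ge1}\bigl(\frac1{z-x+n}-\frac1{z+n}\bigr)=\psi(z+1)-\psi(z-x+1)$.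
\<close>

unbundle no vec_syntax and fps_syntax

section \<open>Recursions for truncated multiple zeta values\<close>

text \<open>A strictly increasing list bounded by \<open>Suc M\<close> can contain
  \<open>Suc M\<close> only as its last entry, and deleting that entry leaves entries at most
  M.\<close>

lemma index_lists_Suc:
  "{ms. length ms = Suc n \<and> sorted_wrt (<) ms \<and> set ms \<subseteq> {1..Suc M}} =
   {ms. length ms = Suc n \<and> sorted_wrt (<) ms \<and> set ms \<subseteq> {1..M}} \<union>
   (\<lambda>ms. ms @ [Suc M]) ` {ms. length ms = n \<and> sorted_wrt (<) ms \<and> set ms \<subseteq> {1..M}}"
  (is "?A = ?B \<union> ?C")
proof (intro equalityI subsetI)
  fix ms assume ms: "ms \<in> ?A"
  then obtain ms' m where eq: "ms = ms' @ [m]"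
    by (metis (mono_tags, lifting) length_Suc_conv_rev mem_Collect_eq)
  have less: "\<forall>i\<in>set ms'. i < m" and m: "m \<le> Suc M" and m1: "1 \<le> m"
    using ms unfolding eq by (auto simp: sorted_wrt_append)
  show "ms \<in> ?B \<union> ?C"
  proof (cases "m = Suc M")
    case True
    have "ms' \<in> {ms. length ms = n \<and> sorted_wrt (<) ms \<and> set ms \<subseteq> {1..M}}"
      using ms less unfolding eq True by (force simp: sorted_wrt_append)
    then show ?thesis unfolding eq True by blast
  next
    case False
    then have "set ms \<subseteq> {1..M}"
      using ms less m m1 unfolding eq by force
    then show ?thesis using ms by simp
  qed
next
  fix ms assume "ms \<in> ?B \<union> ?C"
  then show "ms \<in> ?A" by (force simp: sorted_wrt_append)
qed

lemma finite_index_lists: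
  "finite {ms. length ms = n \<and> sorted_wrt (<) ms \<and> set ms \<subseteq> {1..M::nat}}"
  by (rule finite_subset[OF _ finite_lists_length_eq[of "{1..M}" n]]) auto

lemma mzv_trunc_Nil [simp]: "mzv_trunc [] M = 1"
proof -
  have "{ms. length ms = length ([]::nat list) \<and> sorted_wrt (<) ms \<and> set ms \<subseteq> {1..M}} = {[]}" by auto
  then show ?thesis unfolding mzv_trunc_def by simp
qed

lemma mzv_trunc_snoc_0 [simp]: "mzv_trunc (ks @ [k]) 0 = 0"
proof -
  have "length ms \<noteq> length (ks @ [k])" if "set ms \<subseteq> {1..0}" for ms :: "nat list"
    using that by (cases ms) auto
  then have "{ms. length ms = length (ks @ [k]) \<and> sorted_wrt (<) ms \<and> set ms \<subseteq> {1..0::nat}} = {}"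
    by blast
  then show ?thesis unfolding mzv_trunc_def by (simp only: sum.empty)
qed

text \<open>The largest summation variable belongs to the last exponent, so the terms in which it
  equals \<open>Suc M\<close> peel off the last entry of the index. The later recursions in M come
  from this one.\<close>

lemma mzv_trunc_snoc_Suc:
  "mzv_trunc (ks @ [k]) (Suc M) =
     mzv_trunc (ks @ [k]) M + mzv_trunc ks M / real (Suc M) ^ k"
proof -
  let ?A = "\<lambda>n M. {ms. length ms = n \<and> sorted_wrt (<) ms \<and> set ms \<subseteq> {1..M::nat}}"
  let ?f = "\<lambda>ms. \<Prod>i<Suc (length ks). 1 / real (ms ! i) ^ ((ks @ [k]) ! i)"
  let ?g = "\<lambda>ms. \<Prod>i<length ks. 1 / real (ms ! i) ^ (ks ! i)"
  have disj: "?A (Suc (length ks)) M \<inter> (\<lambda>ms. ms @ [Suc M]) ` ?A (length ks) M = {}"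
    by auto
  have eq: "mzv_trunc (ks @ [k]) M' = sum ?f (?A (Suc (length ks)) M')" for M'
    by (simp only: mzv_trunc_def length_append_singleton)
  have snoc: "?f (ms @ [Suc M]) = ?g ms / real (Suc M) ^ k" if "ms \<in> ?A (length ks) M" for ms
  proof -
    have len: "length ms = length ks" using that by simp
    have "?f (ms @ [Suc M]) =
        (\<Prod>i<length ks. 1 / real ((ms @ [Suc M]) ! i) ^ ((ks @ [k]) ! i)) * (1 / real (Suc M) ^ k)"
      using len by (simp add: nth_append)
    also have "(\<Prod>i<length ks. 1 / real ((ms @ [Suc M]) ! i) ^ ((ks @ [k]) ! i)) = ?g ms"
      using len by (intro prod.cong) (auto simp: nth_append)
    finally show ?thesis by simp
  qed
  have "sum ?f ((\<lambda>ms. ms @ [Suc M]) ` ?A (length ks) M) =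
      (\<Sum>ms\<in>?A (length ks) M. ?f (ms @ [Suc M]))"
    by (subst sum.reindex) (auto simp: inj_on_def)
  also have "\<dots> = (\<Sum>ms\<in>?A (length ks) M. ?g ms / real (Suc M) ^ k)"
    by (intro sum.cong refl snoc)
  also have "\<dots> = mzv_trunc ks M / real (Suc M) ^ k"
    unfolding mzv_trunc_def by (rule sum_divide_distrib[symmetric])
  finally have last: "sum ?f ((\<lambda>ms. ms @ [Suc M]) ` ?A (length ks) M) =
      mzv_trunc ks M / real (Suc M) ^ k" .
  show ?thesis
    unfolding eq index_lists_Suc last[symmetric]
    by (rule sum.union_disjoint[OF finite_index_lists finite_imageI[OF finite_index_lists] disj])
qed

section \<open>Truncated values of the two index families\<close>

definition trunc_ones :: "nat \<Rightarrow> nat \<Rightarrow> real" where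
  "trunc_ones M a = mzv_trunc (replicate a 1) M"

definition trunc_two :: "nat \<Rightarrow> nat \<Rightarrow> nat \<Rightarrow> real" where
  "trunc_two a M c = mzv_trunc (replicate a 1 @ [2] @ replicate c 1) M"

lemma trunc_ones_0 [simp]: "trunc_ones M 0 = 1"
  by (simp add: trunc_ones_def)

lemma trunc_ones_empty [simp]: "trunc_ones 0 (Suc a) = 0"
  using mzv_trunc_snoc_0[of "replicate a 1" 1]
  by (simp add: trunc_ones_def replicate_append_same)

lemma trunc_ones_Suc:
  "trunc_ones (Suc M) (Suc a) = trunc_ones M (Suc a) + trunc_ones M a / real (Suc M)"
  using mzv_trunc_snoc_Suc[of "replicate a 1" 1 M]
  by (simp add: trunc_ones_def replicate_append_same)

lemma trunc_two_empty [simp]: "trunc_two a 0 c = 0"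
proof (cases c)
  case 0
  then show ?thesis using mzv_trunc_snoc_0[of "replicate a 1" 2] by (simp add: trunc_two_def)
next
  case (Suc c')
  then show ?thesis using mzv_trunc_snoc_0[of "replicate a 1 @ [2] @ replicate c' 1" 1]
    by (simp add: trunc_two_def replicate_append_same)
qed

lemma trunc_two_Suc_0:
  "trunc_two a (Suc M) 0 = trunc_two a M 0 + trunc_ones M a / real (Suc M) ^ 2"
  using mzv_trunc_snoc_Suc[of "replicate a 1" 2 M] by (simp add: trunc_two_def trunc_ones_def)

lemma trunc_two_Suc_Suc:
  "trunc_two a (Suc M) (Suc c) = trunc_two a M (Suc c) + trunc_two a M c / real (Suc M)"
  using mzv_trunc_snoc_Suc[of "replicate a 1 @ [2] @ replicate c 1" 1 M]
  by (simp add: trunc_two_def replicate_append_same)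

lemma trunc_ones_eq_0: "M < a \<Longrightarrow> trunc_ones M a = 0"
proof (induction M arbitrary: a)
  case 0
  then show ?case by (cases a) auto
next
  case (Suc M)
  then show ?case by (cases a) (auto simp: trunc_ones_Suc)
qed

text \<open>The index has more than M entries, so no increasing choice of summation variables
  exists. This makes the generating function in z a polynomial.\<close>

lemma trunc_two_eq_0: "M \<le> c \<Longrightarrow> trunc_two a M c = 0"
proof (induction M arbitrary: c)
  case (Suc M)
  then show ?case by (cases c) (auto simp: trunc_two_Suc_Suc)
qed simp

lemma trunc_ones_nonneg: "trunc_ones M a \<ge> 0"
proof (induction M arbitrary: a)
  case 0
  show ?case by (cases a) auto
next
  case (Suc M)
  show ?case using Suc by (cases a) (auto simp: trunc_ones_Suc)
qed

text \<open>These are the two lowest terms in h of the binomial expansion, and the others are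
  nonnegative. Needed for the induction step of \<open>trunc_ones_le_harm\<close>.\<close>

lemma power_Suc_add_mult_le:
  fixes x h :: real
  assumes "x \<ge> 0" "h \<ge> 0"
  shows "x ^ Suc n + real (Suc n) * h * x ^ n \<le> (x + h) ^ Suc n"
proof (induction n)
  case (Suc n)
  have "x ^ Suc (Suc n) + real (Suc (Suc n)) * h * x ^ Suc n
      \<le> (x + h) * (x ^ Suc n + real (Suc n) * h * x ^ n)"
    using assms by (simp add: algebra_simps)
  also have "\<dots> \<le> (x + h) * (x + h) ^ Suc n"
    using Suc assms by (intro mult_left_mono) auto
  finally show ?case by simp
qed simp

text \<open>In the expansion of \<open>harm M ^ a\<close> each product over distinct indices occurs
  \<open>fact a\<close> times. The proof replaces this count by induction on M.\<close>

lemma trunc_ones_le_harm: "trunc_ones M a \<le> harm M ^ a / fact a"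
proof (induction M arbitrary: a)
  case 0
  show ?case by (cases a) (auto simp: harm_def)
next
  case (Suc M)
  show ?case
  proof (cases a)
    case (Suc b)
    have "trunc_ones (Suc M) (Suc b) \<le> harm M ^ Suc b / fact (Suc b) + harm M ^ b / fact b / real (Suc M)"
      unfolding trunc_ones_Suc by (intro add_mono divide_right_mono Suc.IH) auto
    also have "\<dots> = (harm M ^ Suc b + real (Suc b) * inverse (real (Suc M)) * harm M ^ b) / fact (Suc b)"
      by (simp add: field_simps del: of_nat_Suc)
    also have "\<dots> \<le> (harm M + inverse (real (Suc M))) ^ Suc b / fact (Suc b)"
      by (intro divide_right_mono power_Suc_add_mult_le) (auto simp: harm_nonneg)
    finally show ?thesis by (simp only: harm_Suc Suc)
  qed simp
qed

section \<open>Damped generating functions\<close>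

definition elog :: "nat \<Rightarrow> real" where
  "elog M = ln (real M) + euler_mascheroni"

definition damped :: "nat \<Rightarrow> nat \<Rightarrow> real fps" where
  "damped a M = Abs_fps (trunc_two a M) * fps_exp (- elog M)"

text \<open>Passing from M to M+1 multiplies by 1 + z/(M+1) and changes the damping factor. The two
  contributions to the coefficient of z cancel up to second order in 1/M, which is the purpose of
  the damping.\<close>

definition damping_step :: "nat \<Rightarrow> real fps" where
  "damping_step M = (1 + fps_const (1 / real (Suc M)) * fps_X) * fps_exp (elog M - elog (Suc M))"

lemma trunc_two_fps_Suc:
  "Abs_fps (trunc_two a (Suc M)) =
     (1 + fps_const (1 / real (Suc M)) * fps_X) * Abs_fps (trunc_two a M) +
     fps_const (trunc_ones M a / real (Suc M) ^ 2)"
proof (rule fps_ext)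
  fix n
  show "Abs_fps (trunc_two a (Suc M)) $ n =
     ((1 + fps_const (1 / real (Suc M)) * fps_X) * Abs_fps (trunc_two a M) +
     fps_const (trunc_ones M a / real (Suc M) ^ 2)) $ n"
    by (cases n)
      (auto simp: distrib_right mult.assoc trunc_two_Suc_0 trunc_two_Suc_Suc simp del: of_nat_Suc)
qed

lemma damped_Suc:
  "damped a (Suc M) = damping_step M * damped a M +
     fps_const (trunc_ones M a / real (Suc M) ^ 2) * fps_exp (- elog (Suc M))"
proof -
  have "fps_exp (- elog (Suc M)) = fps_exp (elog M - elog (Suc M)) * fps_exp (- elog M)"
    by (simp flip: fps_exp_add_mult)
  then show ?thesis
    unfolding damped_def damping_step_def trunc_two_fps_Suc by (simp add: algebra_simps)
qed

text \<open>This covers $M=0$ because \<open>ln 0 = 0\<close> makes \<open>elog 0 = elog 1\<close>.\<close>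
lemma elog_increment:
  defines "d M \<equiv> elog (Suc M) - elog M"
  shows "0 \<le> d M" "d M \<le> 1" "d M \<le> 2 / real (Suc M)"
    "\<bar>1 / real (Suc M) - d M\<bar> \<le> 2 / real (Suc M) ^ 2"
proof -
  have *: "0 \<le> d M \<and> d M \<le> 1 \<and> d M \<le> 2 / real (Suc M) \<and>
      \<bar>1 / real (Suc M) - d M\<bar> \<le> 2 / real (Suc M) ^ 2"
  proof (cases "M = 0")
    case True
    then show ?thesis by (simp add: d_def elog_def)
  next
    case False
    then have M: "real M \<ge> 1" by simp
    have "1 + 1 / real M = real (Suc M) / real M"
      using M by (simp add: field_simps)
    then have d: "d M = ln (1 + 1 / real M)"
      using M by (simp add: d_def elog_def ln_div del: of_nat_Suc)
    have up: "d M \<le> 1 / real M"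
      unfolding d using M by (intro ln_add_one_self_le_self) auto
    have "ln (1 - 1 / real (Suc M)) \<le> - (1 / real (Suc M))"
      using M ln_add_one_self_le_self2[of "- (1 / real (Suc M))"] by (simp add: field_simps)
    also have "1 - 1 / real (Suc M) = inverse (1 + 1 / real M)"
      using M by (simp add: field_simps)
    finally have low: "1 / real (Suc M) \<le> d M"
      using M unfolding d by (subst (asm) ln_inverse) (auto simp: add_pos_pos)
    \<comment> \<open>Since \<open>d M\<close> lies between 1/(M+1) and 1/M, the width of this
      interval bounds its distance from 1/(M+1). The factor 2 comes from M+1 being at most
      2M.\<close>
    have "1 / real M - 1 / real (Suc M) \<le> 2 / real (Suc M) ^ 2"
    proof -
      have "1 / real M - 1 / real (Suc M) = 2 / (2 * (real M * real (Suc M)))"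
        using M by (simp add: divide_simps)
      also have "\<dots> \<le> 2 / real (Suc M) ^ 2"
      proof -
        have "real (Suc M) ^ 2 \<le> 2 * (real M * real (Suc M))"
          using mult_right_mono[of "real (Suc M)" "2 * real M" "real (Suc M)"] M
          by (simp add: power2_eq_square mult_ac)
        then show ?thesis by (intro frac_le) auto
      qed
      finally show ?thesis .
    qed
    moreover have "1 / real M \<le> 1" "1 / real M \<le> 2 / real (Suc M)" "0 \<le> 1 / real (Suc M)"
      using M by (auto simp: field_simps)
    ultimately show ?thesis using up low by linarith
  qed
  then show "0 \<le> d M" "d M \<le> 1" "d M \<le> 2 / real (Suc M)"
    "\<bar>1 / real (Suc M) - d M\<bar> \<le> 2 / real (Suc M) ^ 2" by auto
qed

lemma damping_step_nth_0 [simp]: "damping_step M $ 0 = 1"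
  by (simp add: damping_step_def)

text \<open>For k = 0 the linear terms cancel by \<open>elog_increment\<close>; for larger k every
  term contains two factors of order 1/M. Keeping the division by \<open>fact k\<close> lets the sum
  over k be bounded independently of its length.\<close>

lemma damping_step_nth_Suc:
  "\<bar>damping_step M $ Suc k\<bar> \<le> 8 / real (Suc M) ^ 2 / fact k"
proof -
  define d where "d = elog (Suc M) - elog M"
  note d = elog_increment[of M, folded d_def]
  have eq: "damping_step M $ Suc k = (- d) ^ Suc k / fact (Suc k) + 1 / real (Suc M) * ((- d) ^ k / fact k)"
    by (simp add: damping_step_def distrib_right mult.assoc d_def)
  show ?thesis
  proof (cases "k = 0")
    case True
    then have "\<bar>damping_step M $ Suc k\<bar> \<le> 2 / real (Suc M) ^ 2"
      using d(4) eq by simp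
    also have "\<dots> \<le> 8 / real (Suc M) ^ 2" by (intro divide_right_mono) auto
    finally show ?thesis using True by simp
  next
    case False
    then obtain j where k: "k = Suc j" by (cases k) auto
    have dd: "d * d \<le> 4 / real (Suc M) ^ 2"
      using mult_mono[OF d(3) d(3)] d(1) by (simp add: power2_eq_square)
    have "d ^ Suc k = d * d * d ^ j" by (simp add: k)
    also have "\<dots> \<le> 4 / real (Suc M) ^ 2 * 1"
      using d(1,2) dd by (intro mult_mono power_le_one) auto
    finally have 1: "d ^ Suc k \<le> 4 / real (Suc M) ^ 2" by simp
    have "d ^ k = d * d ^ j" by (simp add: k)
    also have "\<dots> \<le> 2 / real (Suc M) * 1"
      using d(1-3) by (intro mult_mono power_le_one) auto
    finally have "1 / real (Suc M) * d ^ k \<le> 1 / real (Suc M) * (2 / real (Suc M))"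
      by (intro mult_left_mono) auto
    then have 2: "1 / real (Suc M) * d ^ k \<le> 2 / real (Suc M) ^ 2"
      by (simp add: power2_eq_square)
    have "\<bar>damping_step M $ Suc k\<bar> \<le> d ^ Suc k / fact (Suc k) + 1 / real (Suc M) * (d ^ k / fact k)"
      unfolding eq using d(1)
      by (intro order.trans[OF abs_triangle_ineq]) (simp add: abs_mult power_abs)
    also have "\<dots> \<le> 4 / real (Suc M) ^ 2 / fact k + 2 / real (Suc M) ^ 2 / fact k"
    proof (intro add_mono)
      show "d ^ Suc k / fact (Suc k) \<le> 4 / real (Suc M) ^ 2 / fact k"
        using 1 d(1) by (intro frac_le fact_mono) auto
      show "1 / real (Suc M) * (d ^ k / fact k) \<le> 2 / real (Suc M) ^ 2 / fact k"
        using divide_right_mono[OF 2, of "fact k"] by simp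
    qed
    also have "\<dots> \<le> 8 / real (Suc M) ^ 2 / fact k"
      by (simp add: field_simps)
    finally show ?thesis .
  qed
qed

section \<open>Growth of the increments of the damped coefficients\<close>

lemma exp_sums_divide: "(\<lambda>k. u ^ k / fact k) sums exp u" for u :: "'a :: {real_normed_field, banach}"
  using exp_converges[of u] by (simp add: scaleR_conv_of_real divide_inverse mult.commute)

lemma sum_inverse_fact_le_3: "(\<Sum>k<n. 1 / fact k) \<le> (3::real)"
proof -
  have "(\<lambda>k. 1 / fact k) sums exp (1::real)"
    using exp_sums_divide[of 1] by simp
  then have "(\<Sum>k<n. 1 / fact k) \<le> exp (1::real)"
    by (metis (lifting) divide_nonneg_pos fact_gt_zero sum_le_suminf sums_iff finite_lessThan zero_le_one)
  then show ?thesis using exp_le by linarith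
qed

text \<open>A common majorant of \<open>harm M\<close> and \<open>elog (Suc M)\<close>. Being at
  least 1 for every M, it has monotone powers and can absorb constants.\<close>

definition log_weight :: "nat \<Rightarrow> real" where
  "log_weight M = 1 + ln (real (Suc M))"

lemma log_weight_ge_1: "log_weight M \<ge> 1"
  by (simp add: log_weight_def)

lemma harm_le_log_weight: "harm M \<le> log_weight M"
proof (cases "M = 0")
  case True
  then show ?thesis by (simp add: log_weight_def harm_def)
next
  case False
  have "harm M - ln (real M) \<le> harm 1 - ln (real 1)"
    using False by (intro euler_mascheroni_sequence_decreasing) auto
  moreover have "ln (real M) \<le> ln (real (Suc M))" using False by (intro ln_mono) auto
  ultimately show ?thesis by (simp add: log_weight_def harm_def)
qed

lemma elog_Suc_bounds: "0 \<le> elog (Suc M)" "elog (Suc M) \<le> log_weight M"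
  using euler_mascheroni_pos euler_mascheroni_less_13_over_22
  by (auto simp: elog_def log_weight_def intro!: add_nonneg_nonneg)

text \<open>The constant coefficient of \<open>damping_step\<close> is 1, so the difference involves
  only its higher coefficients, all of order 1/M^2. The constant 24 is 8 from
  \<open>damping_step_nth_Suc\<close> times 3 from \<open>sum_inverse_fact_le_3\<close>.\<close>

lemma damped_increment:
  assumes "\<And>k. k \<le> n \<Longrightarrow> \<bar>damped a M $ k\<bar> \<le> B"
  shows "\<bar>damped a (Suc M) $ n - damped a M $ n\<bar> \<le>
    (24 * B + log_weight M ^ a / fact a * (log_weight M ^ n / fact n)) / real (Suc M) ^ 2"
proof -
  have B: "B \<ge> 0" using assms[of n] by linarith
  have "damped a (Suc M) $ n - damped a M $ n =
      (\<Sum>k<n. damping_step M $ Suc k * damped a M $ (n - Suc k)) +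
      trunc_ones M a / real (Suc M) ^ 2 * ((- elog (Suc M)) ^ n / fact n)"
  proof -
    have "(damping_step M * damped a M) $ n =
        damped a M $ n + (\<Sum>k<n. damping_step M $ Suc k * damped a M $ (n - Suc k))"
      by (simp add: fps_mult_nth atLeast0AtMost sum.atMost_shift)
    then show ?thesis by (simp add: damped_Suc del: of_nat_Suc)
  qed
  also have "\<bar>\<dots>\<bar> \<le> (\<Sum>k<n. 8 / real (Suc M) ^ 2 / fact k * B) +
      log_weight M ^ a / fact a / real (Suc M) ^ 2 * (log_weight M ^ n / fact n)"
  proof (intro order.trans[OF abs_triangle_ineq] add_mono order.trans[OF sum_abs] sum_mono)
    fix k assume "k \<in> {..<n}"
    show "\<bar>damping_step M $ Suc k * damped a M $ (n - Suc k)\<bar> \<le> 8 / real (Suc M) ^ 2 / fact k * B"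
      unfolding abs_mult by (intro mult_mono damping_step_nth_Suc assms) auto
  next
    have "trunc_ones M a \<le> log_weight M ^ a / fact a"
      by (rule order.trans[OF trunc_ones_le_harm])
        (intro divide_right_mono power_mono harm_le_log_weight harm_nonneg, auto)
    moreover have "elog (Suc M) ^ n \<le> log_weight M ^ n"
      by (intro power_mono elog_Suc_bounds)
    moreover have eq: "\<bar>trunc_ones M a / real (Suc M) ^ 2 * ((- elog (Suc M)) ^ n / fact n)\<bar> =
        trunc_ones M a / real (Suc M) ^ 2 * (elog (Suc M) ^ n / fact n)"
      using trunc_ones_nonneg[of M a] elog_Suc_bounds(1)[of M]
      by (simp add: abs_mult power_abs del: of_nat_Suc)
    ultimately show "\<bar>trunc_ones M a / real (Suc M) ^ 2 * ((- elog (Suc M)) ^ n / fact n)\<bar> \<le>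
        log_weight M ^ a / fact a / real (Suc M) ^ 2 * (log_weight M ^ n / fact n)"
      unfolding eq using log_weight_ge_1[of M] elog_Suc_bounds(1)[of M]
      by (intro mult_mono divide_right_mono) auto
  qed
  also have "(\<Sum>k<n. 8 / real (Suc M) ^ 2 / fact k * B) = 8 / real (Suc M) ^ 2 * B * (\<Sum>k<n. 1 / fact k)"
    unfolding sum_distrib_left by (intro sum.cong) auto
  also have "\<dots> \<le> 8 / real (Suc M) ^ 2 * B * 3"
    using B by (intro mult_left_mono sum_inverse_fact_le_3) auto
  finally show ?thesis by (simp add: add_divide_distrib mult_ac)
qed

text \<open>The left side is, up to 4^n, a single term of the exponential series at t/4. With the
  divisor 4, two such factors at \<open>log_weight M\<close> grow only like the square root of M,
  which stays summable against 1/M^2.\<close>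

lemma power_div_fact_le: "t \<ge> 0 \<Longrightarrow> t ^ n / fact n \<le> 4 ^ n * exp (t / 4)" for t :: real
proof -
  assume t: "t \<ge> 0"
  have "(\<Sum>k\<in>{n}. (t / 4) ^ k / fact k) \<le> exp (t / 4)"
    using t exp_sums_divide[of "t / 4"] by (intro order.trans[OF sum_le_suminf[of "\<lambda>k. (t / 4) ^ k / fact k" "{n}"]])
      (simp_all add: sums_iff del: sum.insert)
  then show ?thesis by (simp add: field_simps power_divide)
qed

text \<open>The numerator bounds exp(\<open>log_weight M\<close> / 2), the 2 being a bound for
  exp(1/2). The whole term has order M^(-3/2).\<close>

definition growth :: "nat \<Rightarrow> real" where
  "growth M = 2 * sqrt (real (Suc M)) / real (Suc M) ^ 2"

lemma log_weight_powers_le: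
  "log_weight M ^ a / fact a * (log_weight M ^ n / fact n) / real (Suc M) ^ 2 \<le> 4 ^ (a + n) * growth M"
proof -
  have lw: "log_weight M \<ge> 0" using log_weight_ge_1[of M] by simp
  have "log_weight M ^ a / fact a * (log_weight M ^ n / fact n) \<le>
      4 ^ a * exp (log_weight M / 4) * (4 ^ n * exp (log_weight M / 4))"
    using lw by (intro mult_mono power_div_fact_le) auto
  also have "\<dots> = 4 ^ (a + n) * (exp (1 / 2) * exp (ln (real (Suc M)) / 2))"
    by (simp add: power_add log_weight_def mult_exp_exp mult_ac add_divide_distrib)
  also have "exp (ln (real (Suc M)) / 2) = sqrt (real (Suc M))"
    by (metis exp_ln_iff ln_sqrt of_nat_0_less_iff real_sqrt_gt_0_iff zero_less_Suc less_imp_le)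
  also have "exp (1 / 2) \<le> (2::real)"
    using exp_bound_half[of "1/2::real"] by simp
  finally have "log_weight M ^ a / fact a * (log_weight M ^ n / fact n) \<le>
      4 ^ (a + n) * (2 * sqrt (real (Suc M)))"
    by (simp add: mult_right_mono mult_left_mono)
  from divide_right_mono[OF this, of "real (Suc M) ^ 2"] show ?thesis
    by (simp add: growth_def del: of_nat_Suc)
qed

section \<open>Uniform bounds and convergence\<close>

lemma summable_inverse_square: "summable (\<lambda>M. 1 / real (Suc M) ^ 2)"
  using summable_Suc_iff[of "\<lambda>M. inverse (real M ^ 2)"] inverse_power_summable[of 2, where 'a = real]
  by (simp add: divide_inverse del: of_nat_Suc)

lemma growth_nonneg: "growth M \<ge> 0"
  by (simp add: growth_def)

lemma summable_growth: "summable growth"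
proof -
  have "growth M = 2 * real (Suc M) powr (- 3 / 2)" for M
  proof -
    have "real (Suc M) powr (- 3 / 2) = real (Suc M) powr (1 / 2 - 2)" by simp
    also have "\<dots> = sqrt (real (Suc M)) / real (Suc M) ^ 2"
      by (simp only: powr_diff powr_half_sqrt powr_numeral of_nat_0_le_iff)
    finally show ?thesis by (simp add: growth_def)
  qed
  moreover have "summable (\<lambda>M. 2 * real (Suc M) powr (- 3 / 2))"
    using summable_real_powr_iff[of "- 3 / 2"]
    by (intro summable_mult) (subst summable_Suc_iff[of "\<lambda>M. real M powr (- 3 / 2)"], simp)
  ultimately show ?thesis by presburger
qed

definition damped_bound :: real where
  "damped_bound = exp (24 * (\<Sum>M. 1 / real (Suc M) ^ 2)) * suminf growth"

lemma damped_bound_nonneg: "damped_bound \<ge> 0"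
  unfolding damped_bound_def by (intro mult_nonneg_nonneg suminf_nonneg summable_growth growth_nonneg) auto

text \<open>A discrete Gronwall argument: the recursion contributes factors 1 + 24/(M+1)^2, whose
  product stays bounded, and a summable source \<open>growth\<close>. The bound is uniform in M and
  exponential in a + n, which fixes the radius of convergence.\<close>

lemma damped_le: "\<bar>damped a M $ n\<bar> \<le> 4 ^ (a + n) * damped_bound"
proof -
  define q where "q M = 1 / real (Suc M) ^ 2" for M
  define B where "B M = exp (24 * (\<Sum>j<M. q j)) * (\<Sum>j<M. growth j)" for M
  have q: "q M \<ge> 0" for M by (simp add: q_def)
  have B0: "B M \<ge> 0" for M
    by (simp add: B_def sum_nonneg growth_nonneg)
  \<comment> \<open>Here 1 + t is replaced by exp t, and the new exponential, being at least 1, can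
    multiply the added \<open>growth M\<close>.\<close>
  have B_Suc: "B M * (1 + 24 * q M) + growth M \<le> B (Suc M)" for M
  proof -
    have "B M * (1 + 24 * q M) \<le> B M * exp (24 * q M)"
      by (intro mult_left_mono exp_ge_add_one_self B0)
    also have "\<dots> = exp (24 * (\<Sum>j<Suc M. q j)) * (\<Sum>j<M. growth j)"
      by (simp add: B_def distrib_left exp_add)
    finally have "B M * (1 + 24 * q M) \<le> exp (24 * (\<Sum>j<Suc M. q j)) * (\<Sum>j<M. growth j)" .
    moreover have "1 * growth M \<le> exp (24 * (\<Sum>j<Suc M. q j)) * growth M"
      by (intro mult_right_mono growth_nonneg) (simp add: sum_nonneg q add_nonneg_nonneg)
    ultimately show ?thesis by (simp add: B_def distrib_left)
  qed
  have "\<bar>damped a M $ n\<bar> \<le> 4 ^ (a + n) * B M" for a n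
  proof (induction M arbitrary: n)
    case 0
    have "Abs_fps (trunc_two a 0) = 0" by (rule fps_ext) simp
    then show ?case by (simp add: damped_def B_def)
  next
    case (Suc M)
    \<comment> \<open>Enlarging 4^(a+k) to 4^(a+n) gives one bound for all the lower coefficients,
      as \<open>damped_increment\<close> requires.\<close>
    have le: "\<bar>damped a M $ k\<bar> \<le> 4 ^ (a + n) * B M" if "k \<le> n" for k
    proof -
      have "(4::real) ^ (a + k) * B M \<le> 4 ^ (a + n) * B M"
        using that by (intro mult_right_mono B0 power_increasing) auto
      then show ?thesis using Suc.IH[of k] by linarith
    qed
    have "\<bar>damped a (Suc M) $ n - damped a M $ n\<bar> \<le>
        24 * (4 ^ (a + n) * B M) / real (Suc M) ^ 2 +
        log_weight M ^ a / fact a * (log_weight M ^ n / fact n) / real (Suc M) ^ 2"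
      using damped_increment[OF le] by (simp only: add_divide_distrib)
    also have "\<dots> \<le> 24 * (4 ^ (a + n) * B M) / real (Suc M) ^ 2 + 4 ^ (a + n) * growth M"
      by (intro add_left_mono log_weight_powers_le)
    finally have "\<bar>damped a (Suc M) $ n\<bar> \<le>
        4 ^ (a + n) * B M + (24 * (4 ^ (a + n) * B M) * q M + 4 ^ (a + n) * growth M)"
      using Suc.IH[of n] by (simp add: q_def del: of_nat_Suc)
    also have "\<dots> = 4 ^ (a + n) * (B M * (1 + 24 * q M) + growth M)"
      by (simp add: algebra_simps)
    also have "\<dots> \<le> 4 ^ (a + n) * B (Suc M)"
      by (intro mult_left_mono B_Suc) auto
    finally show ?case .
  qed
  then have "\<bar>damped a M $ n\<bar> \<le> 4 ^ (a + n) * B M" .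
  also have "B M \<le> damped_bound"
    unfolding B_def damped_bound_def q_def
    by (intro mult_mono sum_le_suminf summable_inverse_square summable_growth iffD2[OF exp_le_cancel_iff]
        mult_left_mono sum_nonneg suminf_nonneg) (auto intro: growth_nonneg)
  finally show ?thesis by simp
qed

text \<open>Summing the steps from M to M + k bounds the change of v by f M - f (M + k); letting k
  grow gives both convergence and the rate.\<close>

lemma telescoping_bound:
  fixes v f :: "nat \<Rightarrow> real"
  assumes step: "\<And>M. \<bar>v (Suc M) - v M\<bar> \<le> f M - f (Suc M)" and f: "f \<longlonglongrightarrow> 0"
  shows "v \<longlonglongrightarrow> lim v" "\<bar>v M - lim v\<bar> \<le> f M"
proof -
  have diff: "\<bar>v (M + k) - v M\<bar> \<le> f M - f (M + k)" for M k
  proof (induction k)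
    case (Suc k)
    then show ?case using step[of "M + k"] by simp
  qed simp
  have "summable (\<lambda>M. f M - f (Suc M))"
    using telescope_summable'[OF f] .
  then have "summable (\<lambda>M. v (Suc M) - v M)"
    by (rule summable_comparison_test'[where N = 0]) (use step in auto)
  then have "convergent (\<lambda>M. \<Sum>j<M. v (Suc j) - v j)"
    by (simp add: summable_iff_convergent)
  then have "convergent (\<lambda>M. v M - v 0 + v 0)"
    unfolding sum_lessThan_telescope by (intro convergent_add convergent_const)
  then show lim: "v \<longlonglongrightarrow> lim v"
    by (simp add: convergent_LIMSEQ_iff)
  have "(\<lambda>k. \<bar>v (k + M) - v M\<bar>) \<longlonglongrightarrow> \<bar>lim v - v M\<bar>"
    by (intro tendsto_intros LIMSEQ_ignore_initial_segment lim)
  moreover have "(\<lambda>k. f M - f (k + M)) \<longlonglongrightarrow> f M - 0"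
    by (intro tendsto_intros LIMSEQ_ignore_initial_segment f)
  ultimately have "\<bar>lim v - v M\<bar> \<le> f M - 0"
    by (rule LIMSEQ_le) (use diff[of M] in \<open>auto simp: add.commute\<close>)
  then show "\<bar>v M - lim v\<bar> \<le> f M" by (simp add: abs_minus_commute)
qed

definition damped_lim :: "nat \<Rightarrow> nat \<Rightarrow> real" where
  "damped_lim a n = lim (\<lambda>M. damped a M $ n)"

text \<open>The tail from M on of the increment bounds after division by 4^(a+n). It is free of a
  and n, as the passage to the limit in the double series requires.\<close>

definition damped_error :: "nat \<Rightarrow> real" where
  "damped_error M = (\<Sum>j. 24 * damped_bound * (1 / real (Suc (j + M)) ^ 2) + growth (j + M))"

lemma damped_increment_le:
  "\<bar>damped a (Suc M) $ n - damped a M $ n\<bar> \<le>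
     (24 * (4 ^ (a + n) * damped_bound) + log_weight M ^ a / fact a * (log_weight M ^ n / fact n)) / real (Suc M) ^ 2"
proof (rule damped_increment)
  fix k assume "k \<le> n"
  have "(4::real) ^ (a + k) * damped_bound \<le> 4 ^ (a + n) * damped_bound"
    using \<open>k \<le> n\<close> by (intro mult_right_mono damped_bound_nonneg power_increasing) auto
  then show "\<bar>damped a M $ k\<bar> \<le> 4 ^ (a + n) * damped_bound"
    using damped_le[of a M k] by linarith
qed

text \<open>Consecutive tails differ by exactly one increment bound, so
  \<open>telescoping_bound\<close> applies.\<close>

lemma damped_error_LIMSEQ: "damped_error \<longlonglongrightarrow> 0"
  and damped_lim_error: "\<bar>damped a M $ n - damped_lim a n\<bar> \<le> 4 ^ (a + n) * damped_error M"
proof -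
  define e where "e j = 24 * damped_bound * (1 / real (Suc j) ^ 2) + growth j" for j
  have e: "summable e" unfolding e_def
    by (intro summable_add summable_mult summable_inverse_square summable_growth)
  have err: "damped_error M = (\<Sum>j. e (j + M))" for M
    by (simp add: damped_error_def e_def)
  have err': "damped_error M = suminf e - (\<Sum>j<M. e j)" for M
    unfolding err using suminf_minus_initial_segment[OF e] by simp
  show lim: "damped_error \<longlonglongrightarrow> 0"
    unfolding err' using tendsto_diff[OF tendsto_const[of "suminf e"] summable_LIMSEQ[OF e]] by simp
  have "\<bar>damped a (Suc M) $ n - damped a M $ n\<bar> \<le> 4 ^ (a + n) * e M" for M
    using damped_increment_le[of a M n] log_weight_powers_le[of M a n]
    by (simp add: e_def algebra_simps add_divide_distrib del: of_nat_Suc)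
  then have "\<bar>damped a (Suc M) $ n - damped a M $ n\<bar> \<le>
      4 ^ (a + n) * damped_error M - 4 ^ (a + n) * damped_error (Suc M)" for M
    by (simp add: err' flip: right_diff_distrib)
  moreover have "(\<lambda>M. 4 ^ (a + n) * damped_error M) \<longlonglongrightarrow> 0"
    using tendsto_mult_right_zero[OF lim] by blast
  ultimately show "\<bar>damped a M $ n - damped_lim a n\<bar> \<le> 4 ^ (a + n) * damped_error M"
    unfolding damped_lim_def by (rule telescoping_bound(2))
qed

section \<open>Stuffle regularization\<close>

text \<open>
  The shift $j+2$ is chosen so that minus the derivative is
  $(\log x+j+2)^j(\log x+1)/x^2\ge(\log x+1)^{j+1}/x^2$.
\<close>
definition log_power_tail :: "nat \<Rightarrow> real \<Rightarrow> real" where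
  "log_power_tail j x = (ln x + real (j + 2)) ^ Suc j / x"

text \<open>Provides a telescoping majorant for increments of order log^(j+1) M / M^2. The mean
  value theorem gives z between M+1 and M+2, and z being at most 2(M+1) accounts for the factor
  4.\<close>

lemma log_power_tail_decrease:
  "log_weight M ^ Suc j / real (Suc M) ^ 2 \<le>
     4 * (log_power_tail j (real (Suc M)) - log_power_tail j (real (Suc (Suc M))))"
proof -
  let ?m = "real (Suc M)"
  define y where "y x = ln x + real (j + 2)" for x
  have deriv: "(log_power_tail j has_real_derivative
      (real (Suc j) * y x ^ j - y x ^ Suc j) / x ^ 2) (at x)" if "x \<ge> ?m" for x
  proof -
    have x: "x > 0" using that by simp
    have y: "(y has_real_derivative 1 / x) (at x)"
      unfolding y_def using x by (auto intro!: derivative_eq_intros)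
    have "((\<lambda>x. y x ^ Suc j / x) has_real_derivative
        ((1 + real j) * (1 / x * y x ^ j) * x - y x ^ Suc j * 1) / (x * x)) (at x)"
      using x by (intro DERIV_divide DERIV_power_Suc y DERIV_ident) auto
    moreover have "(\<lambda>x. y x ^ Suc j / x) = log_power_tail j"
      by (simp add: log_power_tail_def y_def fun_eq_iff)
    ultimately show ?thesis using x by (simp add: power2_eq_square add.commute)
  qed
  obtain z where z: "?m < z" "z < real (Suc (Suc M))"
    "log_power_tail j (real (Suc (Suc M))) - log_power_tail j ?m =
       (real (Suc (Suc M)) - ?m) * ((real (Suc j) * y z ^ j - y z ^ Suc j) / z ^ 2)"
    using MVT2[of ?m "real (Suc (Suc M))", OF _ deriv] by auto
  have lw: "log_weight M \<le> 1 + ln z" "log_weight M \<ge> 1"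
    using z(1) log_weight_ge_1 by (auto simp: log_weight_def)
  have y: "1 + ln z \<le> y z" by (simp add: y_def)
  have "log_weight M ^ Suc j = log_weight M * log_weight M ^ j" by simp
  also have "\<dots> \<le> (1 + ln z) * y z ^ j"
    using lw y by (intro mult_mono power_mono) auto
  also have "\<dots> = y z ^ Suc j - real (Suc j) * y z ^ j"
    by (simp add: y_def algebra_simps)
  finally have num: "log_weight M ^ Suc j \<le> y z ^ Suc j - real (Suc j) * y z ^ j" .
  have "z ^ 2 \<le> (2 * ?m) ^ 2"
    using z(1,2) by (intro power_mono) auto
  then have "z ^ 2 \<le> 4 * ?m ^ 2"
    by (simp only: power_mult_distrib) simp
  then have "log_weight M ^ Suc j / (4 * ?m ^ 2) \<le> (y z ^ Suc j - real (Suc j) * y z ^ j) / z ^ 2"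
    using num z(1) lw(2) by (intro frac_le order.trans[OF zero_le_power num]) auto
  also have "\<dots> = log_power_tail j ?m - log_power_tail j (real (Suc (Suc M)))"
    using z(3) by (simp add: diff_divide_distrib)
  finally show ?thesis by (simp add: field_simps)
qed

lemma log_power_tail_bigo:
  "(\<lambda>M. log_power_tail j (real (Suc M))) \<in> O(\<lambda>M. ln (real M) ^ Suc j / real M)"
proof -
  have "(\<lambda>M. ln (real (Suc M)) + real (j + 2)) \<in> O(\<lambda>M. ln (real M))"
    by real_asymp
  moreover have "(\<lambda>M. 1 / real (Suc M)) \<in> O(\<lambda>M. 1 / real M)"
    by real_asymp
  ultimately have "(\<lambda>M. (ln (real (Suc M)) + real (j + 2)) ^ Suc j * (1 / real (Suc M)))
      \<in> O(\<lambda>M. ln (real M) ^ Suc j * (1 / real M))"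
    by (intro landau_o.big.mult landau_o.big_power)
  then show ?thesis by (simp add: log_power_tail_def)
qed

text \<open>The uniform \<open>damped_error\<close> decays only like M^(-1/2). For fixed a and n the
  powers of the logarithm are kept instead, which yields the rate that the definition of the
  regularization demands.\<close>

lemma damped_lim_rate:
  "(\<lambda>M. damped a M $ n - damped_lim a n) \<in> O(\<lambda>M. ln (real M) ^ Suc (a + n) / real M)"
proof -
  \<comment> \<open>The two terms of \<open>damped_increment_le\<close> are each majorized by a
    multiple of \<open>log_weight M ^ Suc (a + n)\<close>, with the summand 1 for the second; the
    outer 4 comes from \<open>log_power_tail_decrease\<close>.\<close>
  define C where "C = 4 * (24 * (4 ^ (a + n) * damped_bound) + 1)"
  define f where "f M = C * log_power_tail (a + n) (real (Suc M))" for M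
  have C: "C > 0" using mult_nonneg_nonneg[OF _ damped_bound_nonneg, of "4 ^ (a + n)"] unfolding C_def by simp
  have step: "\<bar>damped a (Suc M) $ n - damped a M $ n\<bar> \<le> f M - f (Suc M)" for M
  proof -
    have lw: "log_weight M \<ge> 1" by (rule log_weight_ge_1)
    have "log_weight M ^ a / fact a * (log_weight M ^ n / fact n) \<le> log_weight M ^ a * log_weight M ^ n"
      using lw by (intro mult_mono divide_le_eq_1[THEN iffD2] order.trans[OF divide_left_mono[of 1 "fact k" for k]])
        (auto simp: fact_ge_1)
    also have "\<dots> \<le> 1 * log_weight M ^ Suc (a + n)"
      using lw by (simp flip: power_add)
    finally have powers: "log_weight M ^ a / fact a * (log_weight M ^ n / fact n) \<le> 1 * log_weight M ^ Suc (a + n)" .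
    have "24 * (4 ^ (a + n) * damped_bound) * 1 \<le> 24 * (4 ^ (a + n) * damped_bound) * log_weight M ^ Suc (a + n)"
      using damped_bound_nonneg by (intro mult_left_mono one_le_power lw) auto
    with powers have "24 * (4 ^ (a + n) * damped_bound) + log_weight M ^ a / fact a * (log_weight M ^ n / fact n)
        \<le> 24 * (4 ^ (a + n) * damped_bound) * log_weight M ^ Suc (a + n) + 1 * log_weight M ^ Suc (a + n)"
      by linarith
    also have "\<dots> = C / 4 * log_weight M ^ Suc (a + n)"
      by (simp add: C_def algebra_simps)
    finally have le: "24 * (4 ^ (a + n) * damped_bound) + log_weight M ^ a / fact a * (log_weight M ^ n / fact n)
        \<le> C / 4 * log_weight M ^ Suc (a + n)" .
    have "\<bar>damped a (Suc M) $ n - damped a M $ n\<bar> \<le> C / 4 * log_weight M ^ Suc (a + n) / real (Suc M) ^ 2"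
      by (rule order.trans[OF damped_increment_le divide_right_mono[OF le]]) simp
    also have "\<dots> = C / 4 * (log_weight M ^ Suc (a + n) / real (Suc M) ^ 2)" by simp
    also have "\<dots> \<le> C / 4 * (4 * (log_power_tail (a + n) (real (Suc M)) -
        log_power_tail (a + n) (real (Suc (Suc M)))))"
      using C by (intro mult_left_mono log_power_tail_decrease) auto
    finally show ?thesis by (simp add: f_def algebra_simps)
  qed
  have f_bigo: "f \<in> O(\<lambda>M. ln (real M) ^ Suc (a + n) / real M)"
    unfolding f_def using C log_power_tail_bigo by simp
  have "(\<lambda>M. ln (real M) ^ Suc (a + n) / real M) \<in> o(\<lambda>M. 1)"
    by real_asymp
  with f_bigo have "f \<in> o(\<lambda>M. 1)"
    by (rule landau_o.big_small_trans)
  from smalloD_tendsto[OF this] have f: "f \<longlonglongrightarrow> 0" by simp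
  have "\<bar>damped a M $ n - damped_lim a n\<bar> \<le> f M" for M
    unfolding damped_lim_def by (rule telescoping_bound(2)[OF step f])
  then have "(\<lambda>M. damped a M $ n - damped_lim a n) \<in> O(f)"
    by (intro bigoI[of _ 1] always_eventually) (auto intro: order.trans[OF _ abs_ge_self])
  then show ?thesis using f_bigo by (rule landau_o.big_trans)
qed

text \<open>The difference of two candidates tends to 0 along \<open>elog M\<close>, which tends to
  infinity; a nonconstant polynomial would diverge there. This justifies the definite description in
  \<open>stuffle_reg_poly\<close>.\<close>

lemma stuffle_reg_poly_unique:
  assumes "is_stuffle_reg_poly ks P" "is_stuffle_reg_poly ks Q"
  shows "P = Q"
proof -
  have lim: "(\<lambda>M. mzv_trunc ks M - poly R (elog M)) \<longlonglongrightarrow> 0" if R: "is_stuffle_reg_poly ks R" for R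
  proof -
    obtain J where "J > 0" and J: "(\<lambda>M. mzv_trunc ks M - poly R (elog M)) \<in> O(\<lambda>M. ln (real M) powr J / real M)"
      using R unfolding is_stuffle_reg_poly_def elog_def by blast
    have "(\<lambda>M. ln (real M) powr J / real M) \<in> o(\<lambda>M. 1)"
      by real_asymp
    with J have "(\<lambda>M. mzv_trunc ks M - poly R (elog M)) \<in> o(\<lambda>M. 1)"
      by (rule landau_o.big_small_trans)
    then show ?thesis by (drule_tac smalloD_tendsto) simp
  qed
  have "(\<lambda>M. poly (P - Q) (elog M)) \<longlonglongrightarrow> 0"
    using tendsto_diff[OF lim[OF assms(2)] lim[OF assms(1)]] by simp
  moreover have elog: "filterlim elog at_infinity sequentially"
    unfolding elog_def by real_asymp
  ultimately have "degree (P - Q) = 0"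
    using filterlim_compose[OF filterlim_poly_at_infinity elog, of "P - Q"]
      not_tendsto_and_filterlim_at_infinity[OF sequentially_bot] by blast
  then obtain c where c: "P - Q = [:c:]" by (rule degree_eq_zeroE)
  then have "c = 0"
    using \<open>(\<lambda>M. poly (P - Q) (elog M)) \<longlonglongrightarrow> 0\<close> by (simp add: LIMSEQ_const_iff)
  then show ?thesis using c by simp
qed

text \<open>Multiplication by e^(L_M z) undoes the damping, and the sum is the resulting Cauchy
  product.\<close>

lemma trunc_two_conv_damped:
  "trunc_two a M c = (\<Sum>i\<le>c. damped a M $ i * (elog M ^ (c - i) / fact (c - i)))"
proof -
  have "damped a M * fps_exp (elog M) = Abs_fps (trunc_two a M)"
    by (simp add: damped_def mult.assoc flip: fps_exp_add_mult)
  then have "trunc_two a M c = (damped a M * fps_exp (elog M)) $ c" by simp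
  then show ?thesis by (simp add: fps_mult_nth atLeast0AtMost)
qed

text \<open>With T as the variable, this is the coefficient of z^c in e^(Tz) times the series of
  limits \<open>damped_lim a i\<close>. Hence its value at T = 0 is
  \<open>damped_lim a c\<close>.\<close>

definition reg_poly :: "nat \<Rightarrow> nat \<Rightarrow> real poly" where
  "reg_poly a c = (\<Sum>i\<le>c. monom (damped_lim a i / fact (c - i)) (c - i))"

text \<open>In \<open>trunc_two_conv_damped\<close> each damped coefficient is replaced by its
  limit. The error exponent a+i+1 and the power c-i of \<open>elog M\<close> add up to a+c+1 for
  every i, so this serves as J.\<close>

lemma is_stuffle_reg_poly_reg_poly:
  "is_stuffle_reg_poly (replicate a 1 @ [2] @ replicate c 1) (reg_poly a c)"
proof -
  let ?J = "real (Suc (a + c))"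
  have "(\<lambda>M. (damped a M $ i - damped_lim a i) * (elog M ^ (c - i) / fact (c - i)))
      \<in> O(\<lambda>M. ln (real M) ^ Suc (a + c) / real M)" if "i \<le> c" for i
  proof -
    have "(\<lambda>M. elog M) \<in> O(\<lambda>M. ln (real M))"
      unfolding elog_def by real_asymp
    then have "(\<lambda>M. elog M ^ (c - i)) \<in> O(\<lambda>M. ln (real M) ^ (c - i))"
      by (rule landau_o.big_power)
    then have "(\<lambda>M. (damped a M $ i - damped_lim a i) * (elog M ^ (c - i) / fact (c - i)))
      \<in> O(\<lambda>M. ln (real M) ^ Suc (a + i) / real M * ln (real M) ^ (c - i))"
      by (intro landau_o.big.mult damped_lim_rate) simp
    also have "(\<lambda>M. ln (real M) ^ Suc (a + i) / real M * ln (real M) ^ (c - i)) =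
        (\<lambda>M. ln (real M) ^ Suc (a + c) / real M)"
      using that by (intro ext) (simp flip: power_add)
    finally show ?thesis .
  qed
  then have "(\<lambda>M. \<Sum>i\<le>c. (damped a M $ i - damped_lim a i) * (elog M ^ (c - i) / fact (c - i)))
      \<in> O(\<lambda>M. ln (real M) ^ Suc (a + c) / real M)"
    by (intro big_sum_in_bigo) auto
  also have "(\<lambda>M. \<Sum>i\<le>c. (damped a M $ i - damped_lim a i) * (elog M ^ (c - i) / fact (c - i))) =
      (\<lambda>M. mzv_trunc (replicate a 1 @ [2] @ replicate c 1) M - poly (reg_poly a c) (elog M))"
    unfolding trunc_two_def[symmetric]
    by (simp add: trunc_two_conv_damped reg_poly_def poly_sum poly_monom left_diff_distrib
        diff_divide_distrib sum_subtractf)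
  \<comment> \<open>The natural power is exchanged for \<open>powr\<close> where the logarithm is
    positive, that is, from M = 2 on.\<close>
  also have "(\<lambda>M. ln (real M) ^ Suc (a + c) / real M) \<in> O(\<lambda>M. ln (real M) powr ?J / real M)"
  proof (rule bigoI[of _ 1])
    show "\<forall>\<^sub>F M in sequentially. norm (ln (real M) ^ Suc (a + c) / real M) \<le> 1 * norm (ln (real M) powr ?J / real M)"
      using eventually_gt_at_top[of 1]
    proof eventually_elim
      case (elim M)
      then have "ln (real M) > 0" by simp
      then show ?case by (simp only: powr_realpow mult_1 order_refl)
    qed
  qed
  finally show ?thesis
    unfolding is_stuffle_reg_poly_def elog_def by (intro exI[of _ ?J] conjI) auto
qed

lemma mzv_stuffle_eq_damped_lim:
  "mzv_stuffle (replicate a 1 @ [2] @ replicate c 1) = damped_lim a c"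
proof -
  have "stuffle_reg_poly (replicate a 1 @ [2] @ replicate c 1) = reg_poly a c"
    unfolding stuffle_reg_poly_def
    using is_stuffle_reg_poly_reg_poly stuffle_reg_poly_unique by (intro the_equality) blast+
  then have "mzv_stuffle (replicate a 1 @ [2] @ replicate c 1) =
      (\<Sum>i\<le>c. damped_lim a i / fact (c - i) * 0 ^ (c - i))"
    unfolding mzv_stuffle_def by (simp only: reg_poly_def poly_sum poly_monom)
  \<comment> \<open>Because 0^0 = 1, evaluation at 0 leaves only the summand i = c.\<close>
  also have "\<dots> = (\<Sum>i\<in>{c}. damped_lim a i / fact (c - i) * 0 ^ (c - i))"
    by (intro sum.mono_neutral_right) auto
  finally show ?thesis by simp
qed

section \<open>Generating functions in both variables\<close>

definition euler_prod :: "nat \<Rightarrow> complex \<Rightarrow> complex" where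
  "euler_prod M z = (\<Prod>j<M. 1 + z / of_nat (Suc j))"

lemma euler_prod_Suc: "euler_prod (Suc M) z = (1 + z / of_nat (Suc M)) * euler_prod M z"
  by (simp add: euler_prod_def mult.commute)

lemma euler_prod_pochhammer: "euler_prod M z = pochhammer (z + 1) M / fact M"
proof (induction M)
  case (Suc M)
  have "1 + z / of_nat (Suc M) = (z + 1 + of_nat M) / of_nat (Suc M)"
    using of_nat_neq_0[of M, where 'a = complex] by (simp add: divide_simps)
  then show ?case
    by (simp add: euler_prod_Suc Suc.IH pochhammer_Suc mult.commute del: of_nat_Suc)
qed (simp add: euler_prod_def)

text \<open>The values \<open>trunc_ones M a\<close> are the elementary symmetric polynomials of 1,
  1/2, ..., 1/M, and the product is their generating function.\<close>

lemma trunc_ones_sums: "(\<lambda>a. of_real (trunc_ones M a) * x ^ a) sums euler_prod M x" for x :: complex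
proof (induction M)
  case 0
  have "(\<lambda>a. of_real (trunc_ones 0 a) * x ^ a) sums (\<Sum>a\<in>{0}. of_real (trunc_ones 0 a) * x ^ a)"
    by (intro sums_finite) (auto simp: trunc_ones_eq_0)
  then show ?case by (simp add: euler_prod_def)
next
  case (Suc M)
  have "(\<lambda>a. of_real (trunc_ones M (Suc a)) * x ^ Suc a) sums (euler_prod M x - 1)"
    using Suc.IH by (subst sums_Suc_iff) simp
  moreover have "(\<lambda>a. x / of_nat (Suc M) * (of_real (trunc_ones M a) * x ^ a)) sums
      (x / of_nat (Suc M) * euler_prod M x)"
    by (intro sums_mult Suc.IH)
  ultimately have "(\<lambda>a. of_real (trunc_ones M (Suc a)) * x ^ Suc a +
      x / of_nat (Suc M) * (of_real (trunc_ones M a) * x ^ a)) sums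
      (euler_prod M x - 1 + x / of_nat (Suc M) * euler_prod M x)"
    by (rule sums_add)
  also have "(\<lambda>a. of_real (trunc_ones M (Suc a)) * x ^ Suc a +
      x / of_nat (Suc M) * (of_real (trunc_ones M a) * x ^ a)) =
      (\<lambda>a. of_real (trunc_ones (Suc M) (Suc a)) * x ^ Suc a)"
    by (simp add: trunc_ones_Suc fun_eq_iff algebra_simps del: of_nat_Suc)
  finally have "(\<lambda>a. of_real (trunc_ones (Suc M) a) * x ^ a) sums
      (euler_prod M x - 1 + x / of_nat (Suc M) * euler_prod M x + 1)"
    by (subst (asm) sums_Suc_iff) simp
  then show ?case by (simp add: euler_prod_Suc algebra_simps del: of_nat_Suc)
qed

text \<open>The recursion of \<open>trunc_two_fps_Suc\<close> evaluated at a complex z;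
  \<open>trunc_two_sums\<close> identifies it with the series.\<close>

primrec trunc_two_gf :: "nat \<Rightarrow> nat \<Rightarrow> complex \<Rightarrow> complex" where
  "trunc_two_gf a 0 z = 0"
| "trunc_two_gf a (Suc M) z = (1 + z / of_nat (Suc M)) * trunc_two_gf a M z +
     of_real (trunc_ones M a) / of_nat (Suc M) ^ 2"

lemma trunc_two_sums: "(\<lambda>c. of_real (trunc_two a M c) * z ^ c) sums trunc_two_gf a M z" for z :: complex
proof (induction M)
  case 0
  show ?case by simp
next
  case (Suc M)
  have "(\<lambda>c. of_real (trunc_two a M (Suc c)) * z ^ Suc c) sums (trunc_two_gf a M z - of_real (trunc_two a M 0))"
    using Suc.IH by (subst sums_Suc_iff) simp
  moreover have "(\<lambda>c. z / of_nat (Suc M) * (of_real (trunc_two a M c) * z ^ c)) sums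
      (z / of_nat (Suc M) * trunc_two_gf a M z)"
    by (intro sums_mult Suc.IH)
  ultimately have "(\<lambda>c. of_real (trunc_two a M (Suc c)) * z ^ Suc c +
      z / of_nat (Suc M) * (of_real (trunc_two a M c) * z ^ c)) sums
      (trunc_two_gf a M z - of_real (trunc_two a M 0) + z / of_nat (Suc M) * trunc_two_gf a M z)"
    by (rule sums_add)
  also have "(\<lambda>c. of_real (trunc_two a M (Suc c)) * z ^ Suc c +
      z / of_nat (Suc M) * (of_real (trunc_two a M c) * z ^ c)) =
      (\<lambda>c. of_real (trunc_two a (Suc M) (Suc c)) * z ^ Suc c)"
    by (simp add: trunc_two_Suc_Suc fun_eq_iff algebra_simps del: of_nat_Suc)
  finally have "(\<lambda>c. of_real (trunc_two a (Suc M) c) * z ^ c) sums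
      (trunc_two_gf a M z - of_real (trunc_two a M 0) + z / of_nat (Suc M) * trunc_two_gf a M z +
       of_real (trunc_two a (Suc M) 0))"
    by (subst (asm) sums_Suc_iff) simp
  then show ?case by (simp add: trunc_two_Suc_0 algebra_simps del: of_nat_Suc)
qed

text \<open>The Cauchy product of a polynomial in z with the exponential series, both absolutely
  summable.\<close>

lemma damped_sums:
  "(\<lambda>n. of_real (damped a M $ n) * z ^ n) sums (trunc_two_gf a M z * exp (- of_real (elog M) * z))" for z :: complex
proof -
  define f where "f c = of_real (trunc_two a M c) * z ^ c" for c
  define g where "g c = (- of_real (elog M) * z) ^ c / fact c" for c
  have f: "f sums trunc_two_gf a M z"
    unfolding f_def by (rule trunc_two_sums)
  have g: "g sums exp (- of_real (elog M) * z)"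
    unfolding g_def by (rule exp_sums_divide)
  have "summable (\<lambda>c. norm (f c))"
    by (rule summable_finite[of "{..<M}"]) (auto simp: f_def trunc_two_eq_0)
  moreover have "summable (\<lambda>c. norm (g c))"
    using exp_sums_divide[of "norm (- of_real (elog M) * z)", THEN sums_summable]
    unfolding g_def norm_divide norm_power norm_fact .
  ultimately have "(\<lambda>n. \<Sum>i\<le>n. f i * g (n - i)) sums (suminf f * suminf g)"
    by (rule Cauchy_product_sums)
  also have "(\<lambda>n. \<Sum>i\<le>n. f i * g (n - i)) = (\<lambda>n. of_real (damped a M $ n) * z ^ n)"
  proof
    fix n
    have "f i * g (n - i) = of_real (trunc_two a M i * ((- elog M) ^ (n - i) / fact (n - i))) * z ^ n"
      if "i \<le> n" for i
    proof -
      have "z ^ n = z ^ i * z ^ (n - i)" using that by (simp flip: power_add)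
      moreover have "(- of_real (elog M) * z) ^ (n - i) = (- of_real (elog M)) ^ (n - i) * z ^ (n - i)"
        by (rule power_mult_distrib)
      ultimately show ?thesis by (simp only: f_def g_def) simp
    qed
    then have "(\<Sum>i\<le>n. f i * g (n - i)) =
        of_real (\<Sum>i\<le>n. trunc_two a M i * ((- elog M) ^ (n - i) / fact (n - i))) * z ^ n"
      unfolding of_real_sum sum_distrib_right by (intro sum.cong) auto
    also have "(\<Sum>i\<le>n. trunc_two a M i * ((- elog M) ^ (n - i) / fact (n - i))) = damped a M $ n"
      by (simp add: damped_def fps_mult_nth atLeast0AtMost)
    finally show "(\<Sum>i\<le>n. f i * g (n - i)) = of_real (damped a M $ n) * z ^ n" .
  qed
  finally show ?thesis using f g by (simp add: sums_iff)
qed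

primrec trunc_two_double_gf :: "nat \<Rightarrow> complex \<Rightarrow> complex \<Rightarrow> complex" where
  "trunc_two_double_gf 0 x z = 0"
| "trunc_two_double_gf (Suc M) x z = (1 + z / of_nat (Suc M)) * trunc_two_double_gf M x z +
     euler_prod M x / of_nat (Suc M) ^ 2"

lemma trunc_two_gf_sums: "(\<lambda>a. trunc_two_gf a M z * x ^ a) sums trunc_two_double_gf M x z"
proof (induction M)
  case (Suc M)
  have "(\<lambda>a. (1 + z / of_nat (Suc M)) * (trunc_two_gf a M z * x ^ a) +
      of_real (trunc_ones M a) * x ^ a / of_nat (Suc M) ^ 2) sums trunc_two_double_gf (Suc M) x z"
    unfolding trunc_two_double_gf.simps by (intro sums_add sums_mult sums_divide Suc.IH trunc_ones_sums)
  then show ?case by (simp add: algebra_simps del: of_nat_Suc)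
qed simp

text \<open>The majorant suggested by \<open>damped_le\<close> is a product of two geometric series
  of ratios 4|x| and 4|z|, whence the radius 1/4.\<close>

lemma summable_on_geometric_pair:
  fixes x z :: complex
  assumes "norm x < 1 / 4" "norm z < 1 / 4"
  shows "(\<lambda>(a, n). 4 ^ (a + n) * norm x ^ a * norm z ^ n) summable_on UNIV \<times> UNIV"
proof -
  have geo: "((\<lambda>n. (4 * norm y) ^ n) has_sum (1 / (1 - 4 * norm y))) UNIV"
    if "norm y < 1 / 4" for y :: complex
    using that geometric_sums[of "4 * norm y"] by (intro sums_nonneg_imp_has_sum) auto
  have "(\<lambda>p. (4 * norm x) ^ fst p * (4 * norm z) ^ snd p) summable_on UNIV \<times> UNIV"
  proof (rule summable_on_SigmaI)
    show "((\<lambda>n. (4 * norm x) ^ fst (a, n) * (4 * norm z) ^ snd (a, n)) has_sum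
        (4 * norm x) ^ a * (1 / (1 - 4 * norm z))) UNIV" for a
      using has_sum_cmult_right[OF geo[OF assms(2)]] by simp
    show "(\<lambda>a. (4 * norm x) ^ a * (1 / (1 - 4 * norm z))) summable_on UNIV"
      using geo[OF assms(1)] by (intro summable_on_cmult_left) (auto simp: summable_on_def)
  qed auto
  then show ?thesis
    by (simp add: power_mult_distrib power_add mult_ac case_prod_unfold)
qed

lemma damped_gf_infsum:
  assumes "norm x < 1 / 4" "norm z < 1 / 4"
  shows "(\<Sum>\<^sub>\<infinity>(a, n)\<in>UNIV \<times> UNIV. of_real (damped a M $ n) * x ^ a * z ^ n) =
    trunc_two_double_gf M x z * exp (- of_real (elog M) * z)"
    and "(\<lambda>(a, n). of_real (damped a M $ n) * x ^ a * z ^ n) summable_on UNIV \<times> UNIV"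
proof -
  define h where "h a n = of_real (damped a M $ n) * x ^ a * z ^ n" for a n
  have "(\<lambda>p. norm (case p of (a, n) \<Rightarrow> h a n)) summable_on UNIV \<times> UNIV"
  proof (rule Infinite_Sum.abs_summable_on_comparison_test')
    show "(\<lambda>p. damped_bound * (case p of (a, n) \<Rightarrow> 4 ^ (a + n) * norm x ^ a * norm z ^ n)) summable_on UNIV \<times> UNIV"
      by (intro summable_on_cmult_right summable_on_geometric_pair assms)
    fix p :: "nat \<times> nat"
    obtain a n where p: "p = (a, n)" by (cases p)
    have "norm (h a n) = \<bar>damped a M $ n\<bar> * norm x ^ a * norm z ^ n"
      by (simp add: h_def norm_mult norm_power)
    also have "\<dots> \<le> 4 ^ (a + n) * damped_bound * norm x ^ a * norm z ^ n"
      by (intro mult_right_mono damped_le) auto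
    finally show "norm (case p of (a, n) \<Rightarrow> h a n) \<le> damped_bound * (case p of (a, n) \<Rightarrow> 4 ^ (a + n) * norm x ^ a * norm z ^ n)"
      by (simp add: p mult_ac)
  qed
  then have summ: "(\<lambda>(a, n). h a n) summable_on UNIV \<times> UNIV"
    by (rule abs_summable_summable)
  then show "(\<lambda>(a, n). of_real (damped a M $ n) * x ^ a * z ^ n) summable_on UNIV \<times> UNIV"
    by (simp add: h_def)
  have inner: "infsum (h a) UNIV = x ^ a * (trunc_two_gf a M z * exp (- of_real (elog M) * z))" for a
  proof -
    have "h a summable_on UNIV"
      by (rule summable_on_SigmaD1[OF summ]) auto
    then have "h a sums infsum (h a) UNIV"
      by (intro has_sum_imp_sums has_sum_infsum)
    moreover have "h a sums (x ^ a * (trunc_two_gf a M z * exp (- of_real (elog M) * z)))"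
      using sums_mult[OF damped_sums[of a M z], of "x ^ a"] by (simp add: h_def[abs_def] mult_ac)
    ultimately show ?thesis by (rule sums_unique2)
  qed
  \<comment> \<open>Absolute summability permits summing over n first; the unconditional sum over a
    is then identified with an ordered series of known value.\<close>
  have "infsum (\<lambda>(a, n). h a n) (UNIV \<times> UNIV) = infsum (\<lambda>a. infsum (h a) UNIV) UNIV"
    using infsum_Sigma'_banach[OF summ] by simp
  moreover have "(\<lambda>a. infsum (h a) UNIV) sums infsum (\<lambda>a. infsum (h a) UNIV) UNIV"
    using summable_on_Sigma_banach[OF summ] by (intro has_sum_imp_sums has_sum_infsum) simp
  moreover have "(\<lambda>a. infsum (h a) UNIV) sums (trunc_two_double_gf M x z * exp (- of_real (elog M) * z))"
    using sums_mult2[OF trunc_two_gf_sums[of M z x], of "exp (- of_real (elog M) * z)"]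
    by (simp add: inner mult_ac)
  ultimately show "(\<Sum>\<^sub>\<infinity>(a, n)\<in>UNIV \<times> UNIV. of_real (damped a M $ n) * x ^ a * z ^ n) =
    trunc_two_double_gf M x z * exp (- of_real (elog M) * z)"
    unfolding h_def[symmetric] by (metis sums_unique2)
qed

text \<open>By \<open>damped_lim_error\<close> the terms differ from their limits by at most
  \<open>damped_error M\<close> times the geometric majorant, so the double sums converge
  together.\<close>

lemma damped_lim_gf:
  assumes "norm x < 1 / 4" "norm z < 1 / 4"
  shows "(\<lambda>(a, n). of_real (damped_lim a n) * x ^ a * z ^ n) summable_on UNIV \<times> UNIV"
    and "(\<lambda>M. trunc_two_double_gf M x z * exp (- of_real (elog M) * z)) \<longlonglongrightarrow>
      (\<Sum>\<^sub>\<infinity>(a, n)\<in>UNIV \<times> UNIV. of_real (damped_lim a n) * x ^ a * z ^ n)"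
proof -
  define g where "g = (\<lambda>(a, n). 4 ^ (a + n) * norm x ^ a * norm z ^ n)"
  define h where "h M = (\<lambda>(a, n). of_real (damped a M $ n) * x ^ a * z ^ n)" for M
  define l where "l = (\<lambda>(a, n). of_real (damped_lim a n) * x ^ a * z ^ n)"
  have g: "g summable_on UNIV \<times> UNIV"
    unfolding g_def by (rule summable_on_geometric_pair[OF assms])
  have h: "h M summable_on UNIV \<times> UNIV" for M
    unfolding h_def by (rule damped_gf_infsum(2)[OF assms])
  have bound: "norm (h M p - l p) \<le> damped_error M * g p" for M p
  proof -
    obtain a n where p: "p = (a, n)" by (cases p)
    have "h M p - l p = of_real (damped a M $ n - damped_lim a n) * x ^ a * z ^ n"
      by (simp add: h_def l_def p algebra_simps)
    then have "norm (h M p - l p) = \<bar>damped a M $ n - damped_lim a n\<bar> * norm x ^ a * norm z ^ n"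
      by (simp add: norm_mult norm_power del: of_real_diff)
    also have "\<dots> \<le> 4 ^ (a + n) * damped_error M * norm x ^ a * norm z ^ n"
      by (intro mult_right_mono damped_lim_error) auto
    finally show ?thesis by (simp add: g_def p mult_ac)
  qed
  have diff: "(\<lambda>p. norm (h M p - l p)) summable_on UNIV \<times> UNIV" for M
    by (rule Infinite_Sum.abs_summable_on_comparison_test'[OF summable_on_cmult_right[OF g, of "damped_error M"] bound])
  \<comment> \<open>Summability of the limit family follows by writing it as the family for M = 0
    plus an absolutely summable difference.\<close>
  have commute: "norm (l p - h 0 p) = norm (h 0 p - l p)" for p
    by (rule norm_minus_commute)
  have "(\<lambda>p. norm (l p - h 0 p)) summable_on UNIV \<times> UNIV"
    unfolding commute by (rule diff)
  from summable_on_add[OF h[of 0] abs_summable_summable[OF this]]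
  have "(\<lambda>p. h 0 p + (l p - h 0 p)) summable_on UNIV \<times> UNIV" .
  then have l: "l summable_on UNIV \<times> UNIV" by simp
  then show "(\<lambda>(a, n). of_real (damped_lim a n) * x ^ a * z ^ n) summable_on UNIV \<times> UNIV"
    by (simp add: l_def)
  have err: "norm (infsum (h M) (UNIV \<times> UNIV) - infsum l (UNIV \<times> UNIV)) \<le> damped_error M * infsum g (UNIV \<times> UNIV)" for M
  proof -
    have "norm (infsum (h M) (UNIV \<times> UNIV) - infsum l (UNIV \<times> UNIV)) =
        norm (infsum (\<lambda>p. h M p - l p) (UNIV \<times> UNIV))"
      using infsum_add[OF h[of M] summable_on_uminus[THEN iffD2, OF l]] by (simp add: infsum_uminus)
    also have "\<dots> \<le> infsum (\<lambda>p. norm (h M p - l p)) (UNIV \<times> UNIV)"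
      by (rule norm_infsum_bound[OF diff])
    also have "\<dots> \<le> infsum (\<lambda>p. damped_error M * g p) (UNIV \<times> UNIV)"
      by (intro infsum_mono diff summable_on_cmult_right g bound)
    also have "\<dots> = damped_error M * infsum g (UNIV \<times> UNIV)"
      by (rule infsum_cmult_right')
    finally show ?thesis .
  qed
  have "(\<lambda>M. damped_error M * infsum g (UNIV \<times> UNIV)) \<longlonglongrightarrow> 0"
    by (rule tendsto_mult_left_zero[OF damped_error_LIMSEQ])
  then have "(\<lambda>M. infsum (h M) (UNIV \<times> UNIV) - infsum l (UNIV \<times> UNIV)) \<longlonglongrightarrow> 0"
    by (rule Lim_null_comparison[rotated]) (intro always_eventually allI err)
  then have "(\<lambda>M. infsum (h M) (UNIV \<times> UNIV)) \<longlonglongrightarrow> infsum l (UNIV \<times> UNIV)"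
    by (simp add: LIM_zero_cancel)
  then show "(\<lambda>M. trunc_two_double_gf M x z * exp (- of_real (elog M) * z)) \<longlonglongrightarrow>
      (\<Sum>\<^sub>\<infinity>(a, n)\<in>UNIV \<times> UNIV. of_real (damped_lim a n) * x ^ a * z ^ n)"
    unfolding h_def l_def damped_gf_infsum(1)[OF assms] .
qed

text \<open>Gauss's limit for the reciprocal gamma function. Since (z)_{M+1} = z (z+1)_M, the
  sequence is \<open>rGamma_series z\<close> divided by z, up to the factor with Euler's constant;
  the division forces the separate case z = 0.\<close>

lemma euler_prod_LIMSEQ:
  "(\<lambda>M. euler_prod M z * exp (- of_real (elog M) * z)) \<longlonglongrightarrow> rGamma (z + 1) * exp (- euler_mascheroni * z)"
proof (cases "z = 0")
  case True
  then show ?thesis by (simp add: euler_prod_def)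
next
  case False
  have "(\<lambda>M. rGamma_series z M / z * exp (- euler_mascheroni * z)) \<longlonglongrightarrow> rGamma z / z * exp (- euler_mascheroni * z)"
    using False by (intro tendsto_intros)
  moreover have "rGamma_series z M / z * exp (- euler_mascheroni * z) =
      euler_prod M z * exp (- of_real (elog M) * z)" for M
  proof -
    have "- of_real (elog M) * z = - (z * of_real (ln (real M))) + - euler_mascheroni * z"
      by (simp add: elog_def algebra_simps)
    then have "exp (- of_real (elog M) * z) = exp (- (z * of_real (ln (real M)))) * exp (- euler_mascheroni * z)"
      by (simp only: exp_add)
    moreover have "pochhammer z (M + 1) = z * pochhammer (z + 1) M"
      by (simp add: pochhammer_rec)
    ultimately show ?thesis
      using False by (simp add: rGamma_series_def euler_prod_pochhammer exp_minus divide_simps)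
  qed
  moreover have "rGamma z / z = rGamma (z + 1)"
    using False rGamma_plus1[of z] by (simp add: field_simps)
  ultimately show ?thesis by simp
qed

section \<open>Partial sums for differences of the digamma function\<close>

definition digamma_sum :: "nat \<Rightarrow> 'a \<Rightarrow> 'a \<Rightarrow> 'a :: field_char_0" where
  "digamma_sum M x w = (\<Sum>m<M. pochhammer x (Suc m) / (of_nat (Suc m) * pochhammer w (Suc m)))"

text \<open>With R_m = (x)_{m+1} / (w+1)_m, the difference R_m - R_{m+1} is w - x times the summand,
  and R_0 = x. Applied over the complex numbers for the shift and over the reals for a
  majorant.\<close>

lemma sum_pochhammer_ratio:
  fixes x w :: "'a :: field_char_0"
  assumes "w \<noteq> x" and "\<And>n. w + 1 + of_nat n \<noteq> 0"
  shows "(\<Sum>m<M. pochhammer x (Suc m) / pochhammer (w + 1) (Suc m)) =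
    (x - pochhammer x (Suc M) / pochhammer (w + 1) M) / (w - x)"
proof (induction M)
  case (Suc M)
  have nz: "pochhammer (w + 1) M \<noteq> 0"
    using assms(2) by (auto simp: pochhammer_eq_0_iff add_eq_0_iff2)
  define a b c where "a = pochhammer x (Suc M)" and "b = pochhammer (w + 1) M" and "c = w + 1 + of_nat M"
  have "b \<noteq> 0" "c \<noteq> 0" "w - x \<noteq> 0" using nz assms by (auto simp: b_def c_def)
  moreover have "pochhammer (w + 1) (Suc M) = b * c" "pochhammer x (Suc (Suc M)) = a * (c - (w - x))"
    by (simp_all add: a_def b_def c_def pochhammer_Suc algebra_simps)
  ultimately show ?case
    unfolding sum.lessThan_Suc Suc.IH a_def[symmetric] b_def[symmetric]
    by (simp add: divide_simps) (simp add: algebra_simps)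
qed simp

text \<open>From (w+1)_m / (w)_m = (w+m)/w = 1 + m/w: after division by m, the second part loses its
  denominator m and becomes the telescoping sum of \<open>sum_pochhammer_ratio\<close>.\<close>

lemma digamma_sum_shift:
  fixes x w :: "'a :: field_char_0"
  assumes "w \<noteq> x" and nz: "\<And>n. w + of_nat n \<noteq> 0"
  shows "digamma_sum M x w = digamma_sum M x (w + 1) +
    (x - pochhammer x (Suc M) / pochhammer (w + 1) M) / (w * (w - x))"
proof -
  have nz1: "w + 1 + of_nat n \<noteq> 0" for n
    using nz[of "Suc n"] by (simp add: add_ac)
  have w: "w \<noteq> 0" using nz[of 0] by simp
  have "pochhammer x (Suc m) / (of_nat (Suc m) * pochhammer w (Suc m)) =
      pochhammer x (Suc m) / (of_nat (Suc m) * pochhammer (w + 1) (Suc m)) +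
      pochhammer x (Suc m) / pochhammer (w + 1) (Suc m) / w" for m
  proof -
    define b c where "b = pochhammer (w + 1) m" and "c = w + 1 + of_nat m"
    have "b \<noteq> 0" "c \<noteq> 0"
      using nz1 by (auto simp: b_def c_def pochhammer_eq_0_iff add_eq_0_iff2)
    moreover have "pochhammer w (Suc m) = w * b"
      unfolding b_def by (rule pochhammer_rec)
    moreover have "pochhammer (w + 1) (Suc m) = b * c"
      unfolding b_def c_def by (rule pochhammer_Suc)
    moreover have "c = w + of_nat (Suc m)"
      by (simp add: c_def)
    moreover have "of_nat (Suc m) \<noteq> (0 :: 'a)" by (rule of_nat_neq_0)
    ultimately show ?thesis using w
      by (simp add: divide_simps del: of_nat_Suc) (simp add: algebra_simps del: of_nat_Suc)
  qed
  then have "digamma_sum M x w = digamma_sum M x (w + 1) +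
      (\<Sum>m<M. pochhammer x (Suc m) / pochhammer (w + 1) (Suc m)) / w"
    by (simp only: digamma_sum_def sum.distrib sum_divide_distrib)
  then show ?thesis
    using sum_pochhammer_ratio[OF assms(1) nz1] by (simp add: mult.commute)
qed

section \<open>Estimates and limits of Pochhammer ratios\<close>

lemma norm_pochhammer_le: "norm (pochhammer x n) \<le> pochhammer (norm x) n" for x :: complex
proof (induction n)
  case (Suc n)
  have "norm (x + of_nat n) \<le> norm x + real n"
    using norm_triangle_ineq[of x "of_nat n"] by simp
  then show ?case
    unfolding pochhammer_Suc norm_mult using Suc by (intro mult_mono order.trans[OF norm_ge_zero Suc]) auto
qed simp

lemma norm_pochhammer_ge:
  fixes w :: complex
  assumes "0 < r" "r \<le> Re w"
  shows "pochhammer r n \<le> norm (pochhammer w n)"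
proof (induction n)
  case (Suc n)
  have "r + real n \<le> norm (w + of_nat n)"
    using complex_Re_le_cmod[of "w + of_nat n"] assms by simp
  then show ?case
    unfolding pochhammer_Suc norm_mult using Suc assms by (intro mult_mono) (auto intro: pochhammer_nonneg)
qed simp

text \<open>Dropping the factor m and passing to real arguments leaves the telescoping sum with x =
  1/4 and w = t. The bound is uniform in M and tends to 0 as t grows, which controls the remainder
  after many shifts.\<close>

lemma norm_digamma_sum_le:
  fixes x w :: complex
  assumes x: "norm x \<le> 1 / 4" and w: "t + 1 \<le> Re w" and t: "t > 1 / 4"
  shows "norm (digamma_sum M x w) \<le> 1 / 4 / (t - 1 / 4)"
proof -
  have "norm (digamma_sum M x w) \<le>
      (\<Sum>m<M. pochhammer (1 / 4) (Suc m) / pochhammer (t + 1) (Suc m))"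
    unfolding digamma_sum_def
  proof (intro order.trans[OF norm_sum] sum_mono)
    fix m
    have "norm (pochhammer x (Suc m)) \<le> pochhammer (1 / 4) (Suc m)"
    proof (rule order.trans[OF norm_pochhammer_le])
      show "pochhammer (norm x) (Suc m) \<le> pochhammer (1 / 4) (Suc m)"
        unfolding pochhammer_prod using x by (intro prod_mono) auto
    qed
    moreover have pos: "0 < pochhammer (t + 1) (Suc m)" using t by (intro pochhammer_pos) auto
    have "1 * pochhammer (t + 1) (Suc m) \<le> norm (of_nat (Suc m) * pochhammer w (Suc m))"
      unfolding norm_mult norm_of_nat using t w pos
      by (intro mult_mono norm_pochhammer_ge) auto
    ultimately show "norm (pochhammer x (Suc m) / (of_nat (Suc m) * pochhammer w (Suc m))) \<le>
        pochhammer (1 / 4) (Suc m) / pochhammer (t + 1) (Suc m)"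
      unfolding norm_divide using pos by (intro frac_le) (auto intro: pochhammer_nonneg)
  qed
  also have "\<dots> = (1 / 4 - pochhammer (1 / 4) (Suc M) / pochhammer (t + 1) M) / (t - 1 / 4)"
    using t by (intro sum_pochhammer_ratio) (auto simp: add_eq_0_iff)
  also have "\<dots> \<le> 1 / 4 / (t - 1 / 4)"
  proof -
    have "0 \<le> pochhammer (1 / 4) (Suc M) / pochhammer (t + 1) M"
      using t by (intro divide_nonneg_nonneg pochhammer_nonneg) auto
    then have "1 / 4 - pochhammer (1 / 4) (Suc M) / pochhammer (t + 1) M \<le> 1 / 4" by linarith
    then show ?thesis using t by (intro divide_right_mono) auto
  qed
  finally show ?thesis .
qed

text \<open>By Gauss's limit the ratio behaves like a constant times M^(x-w), whose modulus decays
  because Re x < Re w.\<close>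

lemma pochhammer_ratio_LIMSEQ_0:
  fixes x w :: complex
  assumes "w \<notin> \<int>\<^sub>\<le>\<^sub>0" "Re x < Re w"
  shows "(\<lambda>M. pochhammer x (Suc M) / pochhammer (w + 1) M) \<longlonglongrightarrow> 0"
proof -
  have w0: "w \<noteq> 0" using assms(1) by auto
  have rG: "rGamma w \<noteq> 0" using assms(1) by (simp add: rGamma_eq_zero_iff)
  have "(\<lambda>M. exp ((x - w) * of_real (ln (real M)))) \<longlonglongrightarrow> 0"
  proof (rule tendsto_norm_zero_cancel)
    define s where "s = Re w - Re x"
    have "s > 0" using assms(2) by (simp add: s_def)
    then have "(\<lambda>M. exp (- s * ln (real M))) \<longlonglongrightarrow> 0" by real_asymp
    then show "(\<lambda>M. norm (exp ((x - w) * of_real (ln (real M))))) \<longlonglongrightarrow> 0"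
      by (simp add: s_def)
  qed
  then have "(\<lambda>M. w * (rGamma_series x M / rGamma_series w M * exp ((x - w) * of_real (ln (real M))))) \<longlonglongrightarrow>
      w * (rGamma x / rGamma w * 0)"
    by (intro tendsto_intros rG)
  moreover have "w * (rGamma_series x M / rGamma_series w M * exp ((x - w) * of_real (ln (real M)))) =
      pochhammer x (Suc M) / pochhammer (w + 1) M" for M
  proof -
    have "exp ((x - w) * of_real (ln (real M))) =
        exp (x * of_real (ln (real M))) / exp (w * of_real (ln (real M)))"
      by (simp add: left_diff_distrib exp_diff)
    then show ?thesis
      unfolding \<open>exp ((x - w) * of_real (ln (real M))) = _\<close>
      using w0 by (simp add: rGamma_series_def pochhammer_rec[of w] divide_simps)
  qed
  ultimately show ?thesis by simp
qed

text \<open>After N shifts the sum splits into a remainder at z+1+N, the partial sum of the digamma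
  series \<open>d\<close>, and boundary terms \<open>e M n\<close> that vanish as M grows.\<close>

lemma digamma_sum_LIMSEQ:
  fixes x z :: complex
  assumes x: "norm x < 1 / 4" and z: "norm z < 1 / 4"
  shows "(\<lambda>M. digamma_sum M x (z + 1)) \<longlonglongrightarrow> Digamma (z + 1) - Digamma (z - x + 1)"
proof -
  define u where "u M n = pochhammer x (Suc M) / pochhammer (z + 1 + of_nat n + 1) M" for M n
  define d where "d n = inverse (z - x + 1 + of_nat n) - inverse (z + 1 + of_nat n)" for n
  define e where "e M n = u M n / ((z + 1 + of_nat n) * (z + 1 + of_nat n - x))" for M n
  have Re: "\<bar>Re x\<bar> < 1 / 4" "\<bar>Re z\<bar> < 1 / 4"
    using x z abs_Re_le_cmod[of x] abs_Re_le_cmod[of z] by linarith+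
  have nz: "z + 1 + of_nat n \<noteq> 0" "z + 1 + of_nat n \<noteq> x" "z - x + 1 + of_nat n \<noteq> 0" for n
    using Re by (auto simp: complex_eq_iff)
  have split: "digamma_sum M x (z + 1) = digamma_sum M x (z + 1 + of_nat N) + (\<Sum>n<N. d n) - (\<Sum>n<N. e M n)" for M N
  proof (induction N)
    case (Suc N)
    let ?w = "z + 1 + of_nat N"
    have nz': "?w + of_nat n \<noteq> 0" for n
      using nz(1)[of "N + n"] by (simp add: add_ac)
    have "(x - u M N) / (?w * (?w - x)) = d N - e M N"
    proof -
      have "z - x + 1 + of_nat N = ?w - x" by simp
      then show ?thesis
        using nz(1,2)[of N] by (simp only: d_def e_def) (simp add: divide_simps)
    qed
    then have "digamma_sum M x ?w = digamma_sum M x (?w + 1) + (d N - e M N)"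
      using digamma_sum_shift[OF nz(2) nz', of M] by (simp add: u_def)
    moreover have "?w + 1 = z + 1 + of_nat (Suc N)" by simp
    ultimately show ?case using Suc.IH by (simp del: of_nat_Suc)
  qed simp
  have e: "(\<lambda>M. e M n) \<longlonglongrightarrow> 0" for n
  proof -
    have "z + 1 + of_nat n \<notin> \<int>\<^sub>\<le>\<^sub>0"
      using Re by (auto elim!: nonpos_Ints_cases simp: complex_eq_iff)
    then have "(\<lambda>M. u M n) \<longlonglongrightarrow> 0"
      unfolding u_def using Re by (intro pochhammer_ratio_LIMSEQ_0) auto
    then show ?thesis unfolding e_def by (rule tendsto_divide_zero)
  qed
  \<comment> \<open>The logarithms in the two limit formulas for the digamma function cancel,
    leaving the partial sums of \<open>d\<close>.\<close>
  have "(\<lambda>N. (of_real (ln (real N)) - (\<Sum>n<N. inverse (z + 1 + of_nat n))) -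
      (of_real (ln (real N)) - (\<Sum>n<N. inverse (z - x + 1 + of_nat n)))) \<longlonglongrightarrow>
      Digamma (z + 1) - Digamma (z - x + 1)"
    using nz(1)[of 0] nz(3)[of 0] by (intro tendsto_diff Digamma_LIMSEQ) auto
  then have d: "(\<lambda>N. \<Sum>n<N. d n) \<longlonglongrightarrow> Digamma (z + 1) - Digamma (z - x + 1)"
    by (simp add: d_def sum_subtractf)
  \<comment> \<open>With t = N - 1/4, the bound Re z > -1/4 gives t + 1 <= Re (z+1+N), and t - 1/4 =
    N - 1/2.\<close>
  have tail: "norm (digamma_sum M x (z + 1 + of_nat N)) \<le> 1 / 4 / (real N - 1 / 2)" if "N \<ge> 1" for M N
    using norm_digamma_sum_le[of x "real N - 1 / 4" "z + 1 + of_nat N" M] x Re that by simp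
  show ?thesis
  \<comment> \<open>The order of choices matters: N is fixed first, using that the tail bound is
    uniform in M, and then M grows so that the finitely many boundary terms become small.\<close>
  proof (rule tendstoI)
    fix \<epsilon> :: real assume "\<epsilon> > 0"
    have "(\<lambda>N. 1 / 4 / (real N - 1 / 2)) \<longlonglongrightarrow> 0" by real_asymp
    then have "\<forall>\<^sub>F N in sequentially. 1 / 4 / (real N - 1 / 2) < \<epsilon> / 3"
      using \<open>\<epsilon> > 0\<close> by (intro order_tendstoD(2)) auto
    moreover have "\<forall>\<^sub>F N in sequentially. dist (\<Sum>n<N. d n) (Digamma (z + 1) - Digamma (z - x + 1)) < \<epsilon> / 3"
      using \<open>\<epsilon> > 0\<close> by (intro tendstoD[OF d]) auto
    ultimately have "\<forall>\<^sub>F N in sequentially. N \<ge> 1 \<and> 1 / 4 / (real N - 1 / 2) < \<epsilon> / 3 \<and>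
        dist (\<Sum>n<N. d n) (Digamma (z + 1) - Digamma (z - x + 1)) < \<epsilon> / 3"
      by (intro eventually_conj eventually_ge_at_top)
    from eventually_happens'[OF sequentially_bot this] obtain N where N: "N \<ge> 1" "1 / 4 / (real N - 1 / 2) < \<epsilon> / 3"
      "dist (\<Sum>n<N. d n) (Digamma (z + 1) - Digamma (z - x + 1)) < \<epsilon> / 3"
      by blast
    have "(\<lambda>M. \<Sum>n<N. e M n) \<longlonglongrightarrow> (\<Sum>n<N. 0)"
      by (intro tendsto_sum e)
    then have "\<forall>\<^sub>F M in sequentially. dist (\<Sum>n<N. e M n) 0 < \<epsilon> / 3"
      using \<open>\<epsilon> > 0\<close> by (intro tendstoD) auto
    then show "\<forall>\<^sub>F M in sequentially. dist (digamma_sum M x (z + 1)) (Digamma (z + 1) - Digamma (z - x + 1)) < \<epsilon>"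
    proof eventually_elim
      case (elim M)
      define D where "D = Digamma (z + 1) - Digamma (z - x + 1)"
      have "digamma_sum M x (z + 1) - D =
          digamma_sum M x (z + 1 + of_nat N) + (((\<Sum>n<N. d n) - D) - (\<Sum>n<N. e M n))"
        using split[of M N] by simp
      then have "norm (digamma_sum M x (z + 1) - D) \<le>
          norm (digamma_sum M x (z + 1 + of_nat N)) + (norm ((\<Sum>n<N. d n) - D) + norm (\<Sum>n<N. e M n))"
        by (metis norm_triangle_mono norm_triangle_ineq4 order_refl)
      then show ?case
        using tail[OF N(1), of M] N(2,3) elim by (simp add: dist_norm flip: D_def)
    qed
  qed
qed

text \<open>Solves the recursion by variation of constants, with \<open>euler_prod M z\<close> as
  homogeneous solution. The factor x turns (x+1)_M into (x)_{M+1}, and |z| < 1 keeps the divisors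
  (z+1)_n nonzero.\<close>

lemma trunc_two_double_gf_eq:
  assumes "norm z < 1"
  shows "x * trunc_two_double_gf M x z = euler_prod M z * digamma_sum M x (z + 1)"
proof (induction M)
  case 0
  show ?case by (simp add: digamma_sum_def)
next
  case (Suc M)
  have nz: "pochhammer (z + 1) n \<noteq> 0" for n
  proof
    assume "pochhammer (z + 1) n = 0"
    then obtain k where "z = - of_nat (Suc k)"
      by (auto simp: pochhammer_eq_0_iff algebra_simps eq_neg_iff_add_eq_0)
    then have "norm z = real (Suc k)" by (simp only: norm_minus_cancel norm_of_nat)
    then show False using assms by simp
  qed
  have "x * trunc_two_double_gf (Suc M) x z =
      (1 + z / of_nat (Suc M)) * (x * trunc_two_double_gf M x z) + x * euler_prod M x / of_nat (Suc M) ^ 2"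
    by (simp add: algebra_simps del: of_nat_Suc)
  also have "\<dots> = euler_prod (Suc M) z * digamma_sum M x (z + 1) + x * euler_prod M x / of_nat (Suc M) ^ 2"
    unfolding Suc.IH euler_prod_Suc by simp
  also have "x * euler_prod M x / of_nat (Suc M) ^ 2 =
      euler_prod (Suc M) z * (pochhammer x (Suc M) / (of_nat (Suc M) * pochhammer (z + 1) (Suc M)))"
  proof -
    have "fact (Suc M) = of_nat (Suc M) * (fact M :: complex)" by (rule fact_Suc)
    moreover have "of_nat (Suc M) \<noteq> (0 :: complex)" by (rule of_nat_neq_0)
    ultimately show ?thesis
      using nz[of "Suc M"]
      by (simp add: euler_prod_pochhammer pochhammer_rec[of x] power2_eq_square del: of_nat_Suc fact_Suc)
  qed
  finally show ?case by (simp add: digamma_sum_def distrib_left del: of_nat_Suc)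
qed

text \<open>Unconditional convergence on a whole bidisc around (0,0) determines the coefficients, so
  it expresses the identity of power series. The radius 1/4 comes from the coefficient bound of
  order 4^(a+c).\<close>

theorem theoremA4:
  shows "\<exists>r::real. r > 0 \<and> (\<forall>x z :: complex. norm x < r \<longrightarrow> norm z < r \<longrightarrow>
    ((\<lambda>(a, c). complex_of_real (mzv_stuffle (replicate a 1 @ [2] @ replicate c 1)) * x ^ (a + 1) * z ^ c)
      has_sum
      (- (Digamma (z - x + 1) - Digamma (z + 1)) / (Gamma (z + 1) * exp (euler_mascheroni * z))))
    (UNIV \<times> UNIV :: (nat \<times> nat) set))"
proof (intro exI[of _ "1 / 4"] conjI allI impI)
  fix x z :: complex
  assume x: "norm x < 1 / 4" and z: "norm z < 1 / 4"
  define l where "l = (\<lambda>(a, n). of_real (damped_lim a n) * x ^ a * z ^ n)"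
  \<comment> \<open>The factor x supplies the exponent a + 1 and avoids a division by x, so x = 0
    needs no separate treatment.\<close>
  have eq: "x * (trunc_two_double_gf M x z * exp (- of_real (elog M) * z)) =
      euler_prod M z * exp (- of_real (elog M) * z) * digamma_sum M x (z + 1)" for M
    using trunc_two_double_gf_eq[of z x M] z by simp
  have "(\<lambda>M. x * (trunc_two_double_gf M x z * exp (- of_real (elog M) * z))) \<longlonglongrightarrow> x * infsum l (UNIV \<times> UNIV)"
    unfolding l_def by (intro tendsto_mult_left damped_lim_gf(2) x z)
  then have "(\<lambda>M. euler_prod M z * exp (- of_real (elog M) * z) * digamma_sum M x (z + 1))
      \<longlonglongrightarrow> x * infsum l (UNIV \<times> UNIV)"
    unfolding eq .
  moreover have "(\<lambda>M. euler_prod M z * exp (- of_real (elog M) * z) * digamma_sum M x (z + 1)) \<longlonglongrightarrow>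
      rGamma (z + 1) * exp (- euler_mascheroni * z) * (Digamma (z + 1) - Digamma (z - x + 1))"
    by (intro tendsto_mult euler_prod_LIMSEQ digamma_sum_LIMSEQ x z)
  ultimately have value_eq: "x * infsum l (UNIV \<times> UNIV) =
      rGamma (z + 1) * exp (- euler_mascheroni * z) * (Digamma (z + 1) - Digamma (z - x + 1))"
    by (rule LIMSEQ_unique)
  have "(l has_sum infsum l (UNIV \<times> UNIV)) (UNIV \<times> UNIV)"
    unfolding l_def by (intro has_sum_infsum damped_lim_gf(1) x z)
  then have "((\<lambda>p. x * l p) has_sum x * infsum l (UNIV \<times> UNIV)) (UNIV \<times> UNIV)"
    by (rule has_sum_cmult_right)
  moreover have "(\<lambda>p. x * l p) =
      (\<lambda>(a, c). complex_of_real (mzv_stuffle (replicate a 1 @ [2] @ replicate c 1)) * x ^ (a + 1) * z ^ c)"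
    unfolding mzv_stuffle_eq_damped_lim by (auto simp: l_def fun_eq_iff)
  moreover have "x * infsum l (UNIV \<times> UNIV) =
      - (Digamma (z - x + 1) - Digamma (z + 1)) / (Gamma (z + 1) * exp (euler_mascheroni * z))"
    unfolding value_eq by (simp add: rGamma_inverse_Gamma exp_minus divide_inverse)
  ultimately show "((\<lambda>(a, c). complex_of_real (mzv_stuffle (replicate a 1 @ [2] @ replicate c 1)) * x ^ (a + 1) * z ^ c)
      has_sum
      (- (Digamma (z - x + 1) - Digamma (z + 1)) / (Gamma (z + 1) * exp (euler_mascheroni * z))))
    (UNIV \<times> UNIV :: (nat \<times> nat) set)" by simp
qed simp

end
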